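(* Let $H,U$ be Hilbert spaces, let $A:\operatorname{dom}(A)\subset H\to H$ generate a $C_0$-semigroup $\{T(t)\}_{t\ge 0}$ on $H$ with $\|T(t)\|_{\mathcal{B}(H)}\le Me^{\nu t}$ for all $t\ge 0$, where $M\ge 1$, $\nu>0$, and let $B\in\mathcal{B}(U,H)$. Assume that there is a compact operator $F\in\mathcal{B}(H,U)$ such that $A+BF$ generates a $C_0$-semigroup $\{T_{BF}(t)\}_{t\ge0}$ with $\|T_{BF}(t)\|_{\mathcal{B}(H)}\le Ne^{-\xi t}$ for all $t\ge 0$, where $N\ge 1$, $\xi>0$. Let $f:U\to U$ be such that $f\circ F:H\to U$ is globally Lipschitz continuous and, for a constant $\theta_f>0$, $\|f(Fx)-Fx\|_U\le\theta_f\|x\|_H$ for all $x\in H$, and assume $\theta_f<\xi\beta^{-1}$ with $\beta:=MN\|B\|_{\mathcal{B}(U,H)}$. Let $\tau_*>0$ be such that $\Psi_\tau$ is power stable for all $\tau\in(0,\tau_* )$, fix $\tau\in(0,\tau_* )$, and let $G\ge 1$, $\chi>0$ be such that every solution of the sampled-data closed-loop system with sampling period $\tau$ satisfies $\|x(t)\|_H\le Ge^{-\chi t}\|x_0\|_H$ for all $t\ge 0$, $x_0\in H$. Let $V:H\to\mathbb{R}_+$ be a coercive ISS Lyapunov function, with corresponding $\psi_1,\psi_2,\alpha,\gamma\in\mathcal{K}_\infty$, for the disturbed system $\dot x(t)=Ax(t)+Bf(Fx(t))+d(t)$. Fix $\sigma\in(0,1)$, let $\kappa\in\mathcal{KL}$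 be a function with the comparison property for $\alpha$ and $\sigma$, and define $\rho$ and the iterates $\mathcal{R}^{(K)}$, $K\in\mathbb{N}$, as in the context. If there exist $\mu\in\mathcal{KL}$ and $\omega\in\mathcal{L}$ such that $$\mathcal{R}^{(K)}\big(m,\{n_j\}_{j=1}^K\big)\le\mu\Big(\omega(K)m,\max_{1\le j\le K}n_j\Big)\qquad\text{for all }K\in\mathbb{N},\ m\ge 0,\ n_1,\dots,n_K\ge 0,$$ then the origin of the system $\dot x(t)=Ax(t)+Bf(u(t))$, $x(0)=x_0$, subject to the event-triggered controller $$u(t)=Fx(t_k),\quad t\in[t_k,t_{k+1}),\quad t_0=0,$$ $$t_{k+1}=\inf\Big\{t\ge t_k+\tau:\ \gamma\big(\|B[f(Fx(t_k))-f(Fx(t))]\|_H\big)\ge\sigma\,\alpha(V(x(t)))\Big\},\quad k\in\mathbb{N}_0$$ (with $t_{k+1}=\infty$ if the set is empty) is uniformly globally asymptotically stable: there is $\hat\nu\in\mathcal{KL}$ such that for all $x_0\in H$ the solution satisfies $\|x(t)\|_H\le\hat\nu(\|x_0\|_H,t)$ for all $t\ge 0$.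
   Context: Notation: $\mathbb{N}=\{1,2,\dots\}$, $\mathbb{N}_0=\mathbb{N}\cup\{0\}$, $\mathbb{R}_+=[0,\infty)$; $\mathcal{B}(U,H)$ denotes the bounded linear operators from $U$ to $H$, and $\mathcal{B}(H)=\mathcal{B}(H,H)$. Solutions are mild solutions. Comparison functions: $\mathcal{K}$ is the class of continuous strictly increasing functions $g:[0,a)\to\mathbb{R}_+$ with $g(0)=0$; $g\in\mathcal{K}_\infty$ if in addition $a=\infty$ and $g(r)\to\infty$ as $r\to\infty$. A continuous $g:\mathbb{R}_+^2\to\mathbb{R}$ is in $\mathcal{KL}$ if $g(\cdot,\ell)\in\mathcal{K}$ for each $\ell\ge0$ and, for each $r\ge 0$, $g(r,\cdot)$ is decreasing and tends to $0$ at $\infty$. $\mathcal{L}$ is the class of continuous strictly decreasing functions $\omega:\mathbb{R}_+\to\mathbb{R}_+$ with $\omega(s)\to0$ as $s\to\infty$. Sampled-data system with period $\tau$: $\dot x(t)=Ax(t)+Bf(u(t))$, $x(0)=x_0$, with $u(t)=Fx(k\tau)$ for $t\in[k\tau,(k+1)\tau)$, $k\in\mathbb{N}_0$. Associated map: $\Psi_\tau(x):=T(\tau)x+\int_0^\tau T(s)Bf(Fx)\,\mathrm{d}s$, $x\in H$. $\Psi_\tau$ is power stable if there exist $L\in\mathbb{N}$, $q\in(0,1)$ such that for all $x_0\in H$ the sequence $x_{k+1}=\Psi_\tau(x_k)$ satisfies $\|x_k\|_H\le Lq^k\|x_0\|_H$ for all $k\in\mathbb{N}_0$. Under the assumptions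 of the claim such $\tau_*$, $G$, $\chi$ exist. Disturbed system and ISS Lyapunov function: $\mathfrak{D}$ is the set of all locally Lipschitz continuous $d:\mathbb{R}_+\to H$. For $x_0\in H$, $d\in\mathfrak{D}$, $\phi(\cdot;x_0,d)$ denotes the mild solution of $\dot x(t)=Ax(t)+Bf(Fx(t))+d(t)$, $x(0)=x_0$, which exists uniquely on $\mathbb{R}_+$. A continuous $V:H\to\mathbb{R}_+$ is a coercive ISS Lyapunov function for this system if there exist $\psi_1,\psi_2,\alpha,\gamma\in\mathcal{K}_\infty$ with $\psi_1(\|x\|_H)\le V(x)\le\psi_2(\|x\|_H)$ for all $x\in H$ and, for all $x\in H$ and $d\in\mathfrak{D}$, $$\dot V_d(x):=\limsup_{h\to0^+}\frac{V(\phi(h;x,d))-V(x)}{h}\le-\alpha(V(x))+\gamma(\|d(0)\|_H).$$ Comparison property: $\kappa\in\mathcal{KL}$ has the comparison property for $\alpha$ and $\sigma$ if every continuous $y:\mathbb{R}_+\to\mathbb{R}_+$ with $D^+y(t)\le-(1-\sigma)\alpha(y(t))$ for all $t\ge0$ satisfies $y(t)\le\kappa(y(0),t)$ for all $t\ge0$, where $D^+y(t):=\limsup_{h\to0^+}\frac{y(t+h)-y(t)}{h}$. Such a $\kappa$ exists for every $\alpha\in\mathcal{K}_\infty$. Iterates: $\rho(m,n):=\psi_1^{-1}\big(\kappa(\psi_2(Ge^{-\chi\tau}m),n)\big)$ for $m,n\ge0$; $\mathcal{R}^{(1)}(m,\{n\}):=\rho(m,n)$, and $\mathcal{R}^{(K)}(m,\{n_j\}_{j=1}^K):=\rho\big(\mathcal{R}^{(K-1)}(m,\{n_j\}_{j=1}^{K-1}),n_K\big)$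 for $K\ge2$. *)

theory Defs
  imports "HOL-Analysis.Analysis"
begin

(* Hilbert spaces are real throughout: types of sort {real_inner, banach}. A complex Hilbert space
   becomes one by restriction of scalars, with the same norm, operators and semigroups. *)

section \<open>Comparison functions\<close>

text \<open>Functions on \<open>[0, a)\<close> and on \<open>[0, \<infinity>)\<close> are total functions whose values outside that
  interval play no role.\<close>

definition class_K :: "ereal \<Rightarrow> (real \<Rightarrow> real) \<Rightarrow> bool" where
  "class_K a g \<longleftrightarrow> 0 < a \<and> g 0 = 0 \<and>
     continuous_on {r. 0 \<le> r \<and> ereal r < a} g \<and> strict_mono_on {r. 0 \<le> r \<and> ereal r < a} g"

definition class_K_inf :: "(real \<Rightarrow> real) \<Rightarrow> bool" where
  "class_K_inf g \<longleftrightarrow> class_K \<infinity> g \<and> filterlim g at_top at_top"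

definition class_KL :: "(real \<Rightarrow> real \<Rightarrow> real) \<Rightarrow> bool" where
  "class_KL g \<longleftrightarrow>
     continuous_on ({0..} \<times> {0..}) (\<lambda>(r, l). g r l) \<and>
     (\<forall>l\<ge>0. class_K \<infinity> (\<lambda>r. g r l)) \<and>
     (\<forall>r\<ge>0. antimono_on {0..} (g r) \<and> (g r \<longlongrightarrow> 0) at_top)"

definition class_L :: "(real \<Rightarrow> real) \<Rightarrow> bool" where
  "class_L \<omega> \<longleftrightarrow>
     (\<forall>s\<ge>0. 0 \<le> \<omega> s) \<and> continuous_on {0..} \<omega> \<and>
     (\<forall>s\<ge>0. \<forall>t>s. \<omega> t < \<omega> s) \<and> (\<omega> \<longlongrightarrow> 0) at_top"

definition upper_right_Dini :: "(real \<Rightarrow> real) \<Rightarrow> real \<Rightarrow> ereal" where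
  "upper_right_Dini y t = Limsup (at_right 0) (\<lambda>h. ereal ((y (t + h) - y t) / h))"

definition comparison_property ::
    "(real \<Rightarrow> real \<Rightarrow> real) \<Rightarrow> (real \<Rightarrow> real) \<Rightarrow> real \<Rightarrow> bool" where
  "comparison_property \<kappa> \<alpha> \<sigma> \<longleftrightarrow>
     (\<forall>y. continuous_on {0..} y \<and> (\<forall>t\<ge>0. 0 \<le> y t) \<and>
          (\<forall>t\<ge>0. upper_right_Dini y t \<le> ereal (- (1 - \<sigma>) * \<alpha> (y t)))
        \<longrightarrow> (\<forall>t\<ge>0. y t \<le> \<kappa> (y 0) t))"

section \<open>Semigroups and operators\<close>

definition C0_semigroup :: "(real \<Rightarrow> 'h \<Rightarrow>\<^sub>L 'h::real_normed_vector) \<Rightarrow> bool" where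
  "C0_semigroup T \<longleftrightarrow>
     T 0 = id_blinfun \<and>
     (\<forall>s\<ge>0. \<forall>t\<ge>0. T (s + t) = T s o\<^sub>L T t) \<and>
     (\<forall>x. ((\<lambda>t. T t x) \<longlongrightarrow> x) (at_right 0))"

text \<open>The unbounded operator is given by its domain \<open>D\<close> and a total function \<open>A\<close> whose values
  outside \<open>D\<close> play no role.\<close>

definition generates ::
    "'h set \<Rightarrow> ('h \<Rightarrow> 'h) \<Rightarrow> (real \<Rightarrow> 'h \<Rightarrow>\<^sub>L 'h::real_normed_vector) \<Rightarrow> bool" where
  "generates D A T \<longleftrightarrow>
     C0_semigroup T \<and>
     D = {x. \<exists>y. ((\<lambda>h. (T h x - x) /\<^sub>R h) \<longlongrightarrow> y) (at_right 0)} \<and>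
     (\<forall>x\<in>D. ((\<lambda>h. (T h x - x) /\<^sub>R h) \<longlongrightarrow> A x) (at_right 0))"

definition compact_operator :: "('h::real_normed_vector \<Rightarrow>\<^sub>L 'u::real_normed_vector) \<Rightarrow> bool" where
  "compact_operator F \<longleftrightarrow> (\<forall>S. bounded S \<longrightarrow> compact (closure (F ` S)))"

section \<open>Mild solutions\<close>

text \<open>Mild solutions on \<open>[0, \<infinity>)\<close> of \<open>x' = A x + v\<close>, \<open>x(0) = x\<^sub>0\<close>, where \<open>A\<close> generates \<open>T\<close>, i.e.
  \<open>x(t) = T(t) x\<^sub>0 + \<integral>\<^sub>0\<^sup>t T(t - s) v(s) ds\<close>. The Henstock-Kurzweil integral is used because the Bochner
  integral of the library is restricted to separable spaces; for the (piecewise) continuous \<open>v\<close>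
  occurring below both are the Riemann integral.\<close>

definition mild_solution ::
    "(real \<Rightarrow> 'h \<Rightarrow>\<^sub>L 'h::real_normed_vector) \<Rightarrow> (real \<Rightarrow> 'h) \<Rightarrow> 'h \<Rightarrow> (real \<Rightarrow> 'h) \<Rightarrow> bool" where
  "mild_solution T v x0 x \<longleftrightarrow>
     continuous_on {0..} x \<and>
     (\<forall>t\<ge>0. ((\<lambda>s. T (t - s) (v s)) has_integral (x t - T t x0)) {0..t})"

section \<open>The sampled-data system\<close>

definition sampled_data_solution ::
    "(real \<Rightarrow> 'h \<Rightarrow>\<^sub>L 'h::real_normed_vector) \<Rightarrow> ('u::real_normed_vector \<Rightarrow>\<^sub>L 'h) \<Rightarrow> ('u \<Rightarrow> 'u) \<Rightarrow>
     ('h \<Rightarrow>\<^sub>L 'u) \<Rightarrow> real \<Rightarrow> 'h \<Rightarrow> (real \<Rightarrow> 'h) \<Rightarrow> bool" where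
  "sampled_data_solution T B f F \<tau> x0 x \<longleftrightarrow>
     (\<exists>u. (\<forall>k::nat. \<forall>t\<in>{real k * \<tau>..<real (Suc k) * \<tau>}. u t = F (x (real k * \<tau>))) \<and>
          mild_solution T (\<lambda>t. B (f (u t))) x0 x)"

definition sampled_data_map ::
    "(real \<Rightarrow> 'h \<Rightarrow>\<^sub>L 'h::real_normed_vector) \<Rightarrow> ('u::real_normed_vector \<Rightarrow>\<^sub>L 'h) \<Rightarrow> ('u \<Rightarrow> 'u) \<Rightarrow>
     ('h \<Rightarrow>\<^sub>L 'u) \<Rightarrow> real \<Rightarrow> 'h \<Rightarrow> 'h" where
  "sampled_data_map T B f F \<tau> x = T \<tau> x + integral {0..\<tau>} (\<lambda>s. T s (B (f (F x))))"

definition power_stable :: "('h::real_normed_vector \<Rightarrow> 'h) \<Rightarrow> bool" where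
  "power_stable \<Psi> \<longleftrightarrow>
     (\<exists>L::nat. \<exists>q::real. 1 \<le> L \<and> 0 < q \<and> q < 1 \<and>
        (\<forall>x0 k. norm ((\<Psi> ^^ k) x0) \<le> real L * q ^ k * norm x0))"

section \<open>The disturbed system\<close>

definition disturbances :: "(real \<Rightarrow> 'h::real_normed_vector) set" where
  "disturbances = {d. \<forall>t\<ge>0. \<exists>\<epsilon>>0. \<exists>L. L-lipschitz_on (cball t \<epsilon> \<inter> {0..}) d}"

text \<open>Quantifying over all mild solutions \<open>\<phi>\<close> is the same as referring to the solution, since
  solutions of the disturbed system exist and are unique on \<open>[0, \<infinity>)\<close> for Lipschitz \<open>f \<circ> F\<close>.\<close>

definition coercive_ISS_Lyapunov ::
    "(real \<Rightarrow> 'h \<Rightarrow>\<^sub>L 'h::real_normed_vector) \<Rightarrow> ('u::real_normed_vector \<Rightarrow>\<^sub>L 'h) \<Rightarrow> ('u \<Rightarrow> 'u) \<Rightarrow>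
     ('h \<Rightarrow>\<^sub>L 'u) \<Rightarrow> ('h \<Rightarrow> real) \<Rightarrow>
     (real \<Rightarrow> real) \<Rightarrow> (real \<Rightarrow> real) \<Rightarrow> (real \<Rightarrow> real) \<Rightarrow> (real \<Rightarrow> real) \<Rightarrow> bool" where
  "coercive_ISS_Lyapunov T B f F V \<psi>1 \<psi>2 \<alpha> \<gamma> \<longleftrightarrow>
     continuous_on UNIV V \<and> (\<forall>x. 0 \<le> V x) \<and>
     class_K_inf \<psi>1 \<and> class_K_inf \<psi>2 \<and> class_K_inf \<alpha> \<and> class_K_inf \<gamma> \<and>
     (\<forall>x. \<psi>1 (norm x) \<le> V x \<and> V x \<le> \<psi>2 (norm x)) \<and>
     (\<forall>x. \<forall>d\<in>disturbances. \<forall>\<phi>.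
        mild_solution T (\<lambda>s. B (f (F (\<phi> s))) + d s) x \<phi> \<longrightarrow>
        Limsup (at_right 0) (\<lambda>h. ereal ((V (\<phi> h) - V x) / h))
          \<le> ereal (- \<alpha> (V x) + \<gamma> (norm (d 0))))"

section \<open>The iterates\<close>

definition rho ::
    "(real \<Rightarrow> real) \<Rightarrow> (real \<Rightarrow> real) \<Rightarrow> (real \<Rightarrow> real \<Rightarrow> real) \<Rightarrow> real \<Rightarrow> real \<Rightarrow> real \<Rightarrow>
     real \<Rightarrow> real \<Rightarrow> real" where
  "rho \<psi>1 \<psi>2 \<kappa> G \<eta> \<tau> m n = the_inv_into {0..} \<psi>1 (\<kappa> (\<psi>2 (G * exp (- \<eta> * \<tau>) * m)) n)"

text \<open>Only the entries \<open>n 1, \<dots>, n K\<close> are used, and \<open>iterate_R \<rho> 1 m n = \<rho> m (n 1)\<close>.\<close>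

primrec iterate_R :: "(real \<Rightarrow> real \<Rightarrow> real) \<Rightarrow> nat \<Rightarrow> real \<Rightarrow> (nat \<Rightarrow> real) \<Rightarrow> real" where
  "iterate_R \<rho> 0 m n = m"
| "iterate_R \<rho> (Suc K) m n = \<rho> (iterate_R \<rho> K m n) (n (Suc K))"

section \<open>The event-triggered system\<close>

text \<open>The infimum is taken in the extended reals, so it is \<open>\<infinity>\<close> on the empty set; once \<open>t k = \<infinity>\<close>, all
  later events are at \<open>\<infinity>\<close> and impose no condition on \<open>u\<close>. Hence \<open>real_of_ereal (t k)\<close> matters only
  for finite \<open>t k\<close>.\<close>

definition event_triggered_solution ::
    "(real \<Rightarrow> 'h \<Rightarrow>\<^sub>L 'h::real_normed_vector) \<Rightarrow> ('u::real_normed_vector \<Rightarrow>\<^sub>L 'h) \<Rightarrow> ('u \<Rightarrow> 'u) \<Rightarrow>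
     ('h \<Rightarrow>\<^sub>L 'u) \<Rightarrow> ('h \<Rightarrow> real) \<Rightarrow> (real \<Rightarrow> real) \<Rightarrow> (real \<Rightarrow> real) \<Rightarrow> real \<Rightarrow> real \<Rightarrow>
     'h \<Rightarrow> (real \<Rightarrow> 'h) \<Rightarrow> bool" where
  "event_triggered_solution T B f F V \<alpha> \<gamma> \<sigma> \<tau> x0 x \<longleftrightarrow>
     (\<exists>(t :: nat \<Rightarrow> ereal) u.
        t 0 = 0 \<and>
        (\<forall>k. t (Suc k) =
           Inf (ereal ` {s. ereal s \<ge> t k + ereal \<tau> \<and>
                  \<gamma> (norm (B (f (F (x (real_of_ereal (t k)))) - f (F (x s))))) \<ge> \<sigma> * \<alpha> (V (x s))})) \<and>
        (\<forall>k s. t k \<le> ereal s \<and> ereal s < t (Suc k) \<longrightarrow> u s = F (x (real_of_ereal (t k)))) \<and>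
        mild_solution T (\<lambda>s. B (f (u s))) x0 x)"

text \<open>Here \<open>sol x0 x\<close> says that \<open>x\<close> is a solution with initial value \<open>x0\<close>. The existence of a global
  solution is part of the notion, so that it cannot hold vacuously.\<close>

definition UGAS :: "('h::real_normed_vector \<Rightarrow> (real \<Rightarrow> 'h) \<Rightarrow> bool) \<Rightarrow> bool" where
  "UGAS sol \<longleftrightarrow>
     (\<exists>\<nu>. class_KL \<nu> \<and>
        (\<forall>x0. (\<exists>x. sol x0 x) \<and> (\<forall>x. sol x0 x \<longrightarrow> (\<forall>t\<ge>0. norm (x t) \<le> \<nu> (norm x0) t))))"

end

theory Submission
  imports Defs
begin

text \<open>The time axis is cut at the events \<open>t\<^sub>k\<close>. On \<open>[t\<^sub>k, t\<^sub>k + \<tau>]\<close> the event-triggered system is the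
  sampled-data system started at \<open>x(t\<^sub>k)\<close>, so \<open>\<parallel>x\<parallel>\<close> obeys the given exponential estimate and reaches
  \<open>t\<^sub>k + \<tau>\<close> with norm at most \<open>G e\<^bsup>-\<eta>\<tau>\<^esup> \<parallel>x(t\<^sub>k)\<parallel>\<close>. On \<open>[t\<^sub>k + \<tau>, t\<^sub>k\<^sub>+\<^sub>1)\<close> no event occurs, so the error
  \<open>d = B(f(F x(t\<^sub>k)) - f(F x))\<close> satisfies \<open>\<gamma>(\<parallel>d\<parallel>) < \<sigma> \<alpha>(V(x))\<close>; there \<open>x\<close> solves the disturbed system
  with disturbance \<open>d\<close>, and \<open>V(x)\<close> has Dini derivative at most \<open>-(1 - \<sigma>) \<alpha>(V(x))\<close>. The comparison
  function then gives \<open>\<parallel>x(t)\<parallel> \<le> \<rho>(\<parallel>x(t\<^sub>k)\<parallel>, t - t\<^sub>k - \<tau>)\<close> (\<open>norm_flow_before_event_le_rho\<close>). Composing these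
  estimates yields the iterates of \<open>\<rho>\<close>, hence the bound \<open>\<mu>(\<omega>(K) m, max n\<^sub>j)\<close>. This decays in time: \<open>K\<close>
  rounds with gaps at most \<open>N\<close> last at most \<open>K(\<tau> + N)\<close>, so at a late time either \<open>K\<close> or \<open>N\<close> is large
  (\<open>KL_bound_of_count_and_gap\<close>, \<open>norm_le_KL_bound_of_iterates\<close>).

  One step is delicate. The Lyapunov inequality is available for locally Lipschitz disturbances only,
  whereas a mild solution \<open>x\<close>, and with it \<open>d\<close>, is merely continuous in time. Between events, however,
  \<open>x\<close> solves \<open>x' = A x + w\<close> with the constant input \<open>w = B f(F x(t\<^sub>k))\<close>, and the solution of this equation
  is Lipschitz as soon as its initial value has a Lipschitz orbit under \<open>T\<close>. Such initial values, for
  example the averages \<open>(1/\<delta>) \<integral>\<^sub>0\<^sup>\<delta> T(r) p dr\<close>, are dense (\<open>lipschitz_orbits_dense\<close>). For them the inequality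
  holds at all times; in integrated form it contains no derivative, and passes to the limit by
  continuity of \<open>V\<close>. Hence it holds for all initial values (\<open>Dini_Lyapunov_flow\<close>).

  Solutions are built by gluing such constant-input solutions at the switching times, which are at
  least \<open>\<tau>\<close> apart and therefore exhaust the half-line (\<open>ex_switched_solution\<close>). Applied with period
  \<open>\<tau>\<close> this produces the sampled-data solutions to which the exponential estimate is applied; applied
  with the time to the next event it produces the event-triggered solutions.\<close>

section \<open>Comparison functions\<close>

lemma class_K_infinity_iff:
  "class_K \<infinity> g \<longleftrightarrow> g 0 = 0 \<and> continuous_on {0..} g \<and> strict_mono_on {0..} g"
proof -
  have "{r. 0 \<le> r \<and> ereal r < \<infinity>} = {0..}"
    by auto
  then show ?thesis
    by (simp add: class_K_def)
qed

lemma class_K_mono: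
  assumes "class_K \<infinity> g" "0 \<le> r" "r \<le> s"
  shows "g r \<le> g s"
  using assms strict_mono_onD[of "{0..}" g r s]
  by (cases "r = s") (force simp: class_K_infinity_iff)+

lemma class_K_less:
  assumes "class_K \<infinity> g" "0 \<le> r" "r < s"
  shows "g r < g s"
  using assms strict_mono_onD[of "{0..}" g r s] by (auto simp: class_K_infinity_iff)

lemma class_K_nonneg:
  assumes "class_K \<infinity> g" "0 \<le> r"
  shows "0 \<le> g r"
  using class_K_mono[OF assms(1), of 0 r] assms by (simp add: class_K_infinity_iff)

lemma class_K_inf_inverse:
  assumes g: "class_K_inf g" and y: "0 \<le> y"
  shows "0 \<le> the_inv_into {0..} g y" and "g (the_inv_into {0..} g y) = y"
proof -
  have K: "class_K \<infinity> g" and lim: "filterlim g at_top at_top"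
    using g by (auto simp: class_K_inf_def)
  have "eventually (\<lambda>x. y \<le> g x \<and> 0 \<le> x) at_top"
    using lim by (intro eventually_conj) (auto simp: filterlim_at_top eventually_ge_at_top)
  then obtain b where b: "y \<le> g b" "0 \<le> b"
    by (auto simp: eventually_at_top_linorder)
  have "\<exists>x. 0 \<le> x \<and> x \<le> b \<and> g x = y"
    using K b y by (intro IVT') (auto simp: class_K_infinity_iff intro: continuous_on_subset)
  then have y_image: "y \<in> g ` {0..}"
    by auto
  have inj: "inj_on g {0..}"
    using K by (simp add: class_K_infinity_iff strict_mono_on_imp_inj_on)
  show "0 \<le> the_inv_into {0..} g y"
    using the_inv_into_into[OF inj y_image, of "{0..}"] by simp
  show "g (the_inv_into {0..} g y) = y"
    by (rule f_the_inv_into_f[OF inj y_image])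
qed

lemma class_K_inf_le_inverse:
  assumes g: "class_K_inf g" and "0 \<le> x" "g x \<le> y"
  shows "x \<le> the_inv_into {0..} g y"
proof (rule ccontr)
  assume "\<not> ?thesis"
  have K: "class_K \<infinity> g"
    using g by (simp add: class_K_inf_def)
  have "0 \<le> y"
    using class_K_nonneg[OF K \<open>0 \<le> x\<close>] assms by simp
  with class_K_less[OF K, of "the_inv_into {0..} g y" x] \<open>\<not> ?thesis\<close>
  show False
    using class_K_inf_inverse[OF g, of y] \<open>g x \<le> y\<close> by simp
qed

lemma class_KL_fstD: "class_KL g \<Longrightarrow> 0 \<le> l \<Longrightarrow> class_K \<infinity> (\<lambda>r. g r l)"
  by (simp add: class_KL_def)

lemma class_KL_mono:
  assumes g: "class_KL g" and "0 \<le> r" "r \<le> r'" "0 \<le> l'" "l' \<le> l"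
  shows "g r l \<le> g r' l'"
proof -
  have "g r l \<le> g r l'"
    using g assms by (auto simp: class_KL_def monotone_on_def)
  also have "\<dots> \<le> g r' l'"
    using class_K_mono[OF class_KL_fstD[OF g \<open>0 \<le> l'\<close>]] assms by simp
  finally show ?thesis .
qed

lemma class_KL_nonneg: "class_KL g \<Longrightarrow> 0 \<le> r \<Longrightarrow> 0 \<le> l \<Longrightarrow> 0 \<le> g r l"
  using class_K_nonneg[OF class_KL_fstD] by blast

lemma class_L_pos: "class_L \<omega> \<Longrightarrow> 0 \<le> s \<Longrightarrow> 0 < \<omega> s"
  unfolding class_L_def using le_less_trans[of 0 "\<omega> (s + 1)" "\<omega> s"] by simp

lemma class_L_antimono: "class_L \<omega> \<Longrightarrow> 0 \<le> s \<Longrightarrow> s \<le> t \<Longrightarrow> \<omega> t \<le> \<omega> s"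
  unfolding class_L_def by (cases "s = t") (auto simp: less_le)

lemma class_KL_continuous_compose:
  assumes "class_KL g" "continuous_on S a" "continuous_on S b"
    and "\<And>x. x \<in> S \<Longrightarrow> 0 \<le> a x" "\<And>x. x \<in> S \<Longrightarrow> 0 \<le> b x"
  shows "continuous_on S (\<lambda>x. g (a x) (b x))"
proof -
  have "continuous_on S ((\<lambda>(r, l). g r l) \<circ> (\<lambda>x. (a x, b x)))"
    using assms by (intro continuous_on_compose continuous_on_Pair)
      (auto simp: class_KL_def elim!: continuous_on_subset)
  then show ?thesis
    by (simp add: o_def)
qed

text \<open>From \<open>t \<le> K (\<tau> + N)\<close> it follows that \<open>K \<ge> \<surd>t\<close> or \<open>N \<ge> \<surd>t - \<tau>\<close>. In the first case \<open>\<omega>\<close> makes the first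
  argument of \<open>\<mu>\<close> small, in the second case \<open>\<mu>\<close> is small through its second argument; each case is
  covered by one summand, and both summands tend to \<open>0\<close> as \<open>t\<close> grows.\<close>

lemma KL_bound_of_count_and_gap:
  assumes \<mu>: "class_KL \<mu>" and \<omega>: "class_L \<omega>"
    and "0 \<le> K" "0 \<le> N" "0 \<le> r" "0 \<le> t" and \<tau>: "0 \<le> \<tau>" and t: "t \<le> K * (\<tau> + N)"
  shows "\<mu> (\<omega> K * r) N \<le> \<mu> (\<omega> (sqrt t) * r) 0 + \<mu> (\<omega> 0 * r) (max 0 (sqrt t - \<tau>))"
proof -
  have pos: "0 \<le> \<omega> s * r" if "0 \<le> s" for s
    using class_L_pos[OF \<omega> that] \<open>0 \<le> r\<close> by simp
  have nn: "0 \<le> \<mu> (\<omega> (sqrt t) * r) 0" "0 \<le> \<mu> (\<omega> 0 * r) (max 0 (sqrt t - \<tau>))"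
    by (rule class_KL_nonneg[OF \<mu>]; use \<open>0 \<le> t\<close> pos in simp)+
  show ?thesis
  proof (cases "sqrt t \<le> K")
    case True
    have "\<mu> (\<omega> K * r) N \<le> \<mu> (\<omega> (sqrt t) * r) 0"
      using pos[OF \<open>0 \<le> K\<close>] \<open>0 \<le> N\<close> \<open>0 \<le> t\<close>
        mult_right_mono[OF class_L_antimono[OF \<omega> _ True] \<open>0 \<le> r\<close>]
      by (intro class_KL_mono[OF \<mu>]) simp_all
    with nn show ?thesis by simp
  next
    case False
    have "sqrt t * sqrt t \<le> sqrt t * (\<tau> + N)"
      using False assms mult_right_mono[of K "sqrt t" "\<tau> + N"] by simp
    then have "sqrt t \<le> \<tau> + N"
      by (rule mult_left_le_imp_le) (use False \<open>0 \<le> K\<close> in linarith)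
    then have "\<mu> (\<omega> K * r) N \<le> \<mu> (\<omega> 0 * r) (max 0 (sqrt t - \<tau>))"
      using pos[OF \<open>0 \<le> K\<close>] \<open>0 \<le> N\<close>
        mult_right_mono[OF class_L_antimono[OF \<omega> order_refl \<open>0 \<le> K\<close>] \<open>0 \<le> r\<close>]
      by (intro class_KL_mono[OF \<mu>]) simp_all
    with nn show ?thesis by simp
  qed
qed

text \<open>The function that will bound the event-triggered solutions. The first summand
  covers the dwell interval that starts at time \<open>0\<close>. In the other two, time is shifted by
  \<open>\<tau>\<close> because at time \<open>t\<close> only the rounds completed before the current dwell interval count.\<close>

lemma class_KL_event_bound:
  fixes \<tau> :: real
  assumes \<mu>: "class_KL \<mu>" and \<omega>: "class_L \<omega>" and G: "0 < G" and \<eta>: "0 < \<eta>"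
  defines "S \<equiv> \<lambda>t. sqrt (max 0 (t - \<tau>))"
  shows "class_KL (\<lambda>r t. G * exp (- \<eta> * t) * r +
           G * (\<mu> (\<omega> (S t) * r) 0 + \<mu> (\<omega> 0 * r) (max 0 (S t - \<tau>))))"
    (is "class_KL ?\<nu>")
proof -
  have S0: "0 \<le> S t" for t
    by (simp add: S_def)
  have S_mono: "S s \<le> S t" if "s \<le> t" for s t
    using that by (auto simp: S_def)
  have S_top: "filterlim S at_top at_top"
  proof -
    have "filterlim (\<lambda>t. sqrt (t - \<tau>)) at_top at_top"
      by (rule filterlim_compose[OF sqrt_at_top])
        (rule filterlim_tendsto_add_at_top[of "\<lambda>_. -\<tau>" "-\<tau>" _ "\<lambda>t. t", simplified, OF filterlim_ident])
    then show ?thesis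
      by (rule filterlim_at_top_mono) (auto simp: S_def)
  qed
  have S_cont: "continuous_on A (\<lambda>x. S (g x))" if "continuous_on A g" for A and g :: "real \<times> real \<Rightarrow> real"
    unfolding S_def by (intro continuous_intros that)
  have \<omega>_pos: "0 < \<omega> s" if "0 \<le> s" for s
    by (rule class_L_pos[OF \<omega> that])
  have \<omega>S_cont: "continuous_on ({0..} \<times> {0..}) (\<lambda>x :: real \<times> real. \<omega> (S (snd x)))"
    by (rule continuous_on_compose2[of "{0..}" \<omega>])
      (use \<omega> S0 S_cont[OF continuous_on_snd[OF continuous_on_id]] in \<open>auto simp: class_L_def\<close>)
  have cont: "continuous_on ({0..} \<times> {0..}) (\<lambda>(r, t). ?\<nu> r t)"
    unfolding case_prod_unfold
    by (intro continuous_intros class_KL_continuous_compose[OF \<mu>] \<omega>S_cont S_cont)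
      (auto intro!: mult_nonneg_nonneg less_imp_le[OF \<omega>_pos] S0)
  have K: "class_K \<infinity> (\<lambda>r. ?\<nu> r t)" if t: "0 \<le> t" for t
    unfolding class_K_infinity_iff
  proof (intro conjI)
    have z: "\<mu> 0 l = 0" if "0 \<le> l" for l
      using class_KL_fstD[OF \<mu> that] by (simp add: class_K_infinity_iff)
    show "?\<nu> 0 t = 0"
      by (simp add: z)
    show "continuous_on {0..} (\<lambda>r. ?\<nu> r t)"
      using class_KL_fstD[OF \<mu>] less_imp_le[OF \<omega>_pos[OF S0, of t]] less_imp_le[OF \<omega>_pos[of 0]]
      by (intro continuous_intros class_KL_continuous_compose[OF \<mu>]) auto
    show "strict_mono_on {0..} (\<lambda>r. ?\<nu> r t)"
    proof (rule strict_mono_onI)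
      fix r s :: real assume rs: "r \<in> {0..}" "s \<in> {0..}" "r < s"
      have "G * exp (- \<eta> * t) * r < G * exp (- \<eta> * t) * s"
        using rs G by simp
      moreover have "\<mu> (\<omega> (S t) * r) 0 \<le> \<mu> (\<omega> (S t) * s) 0"
        "\<mu> (\<omega> 0 * r) (max 0 (S t - \<tau>)) \<le> \<mu> (\<omega> 0 * s) (max 0 (S t - \<tau>))"
        using rs less_imp_le[OF \<omega>_pos[OF S0, of t]] less_imp_le[OF \<omega>_pos[of 0]]
        by (auto intro!: class_KL_mono[OF \<mu>] mult_left_mono mult_nonneg_nonneg)
      ultimately show "?\<nu> r t < ?\<nu> s t"
        using G by (intro add_less_le_mono mult_left_mono add_mono) auto
    qed
  qed
  have anti: "antimono_on {0..} (?\<nu> r)" if r: "0 \<le> r" for r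
  proof (rule monotone_onI)
    fix s t :: real assume st: "s \<in> {0..}" "t \<in> {0..}" "s \<le> t"
    have "G * exp (- \<eta> * t) * r \<le> G * exp (- \<eta> * s) * r"
      using st G r \<eta> by (intro mult_right_mono mult_left_mono) auto
    moreover have "\<mu> (\<omega> (S t) * r) 0 \<le> \<mu> (\<omega> (S s) * r) 0"
      using r class_L_antimono[OF \<omega> S0 S_mono[OF st(3)]] less_imp_le[OF \<omega>_pos[OF S0, of t]]
      by (intro class_KL_mono[OF \<mu>]) (auto intro: mult_right_mono)
    moreover have "\<mu> (\<omega> 0 * r) (max 0 (S t - \<tau>)) \<le> \<mu> (\<omega> 0 * r) (max 0 (S s - \<tau>))"
      using r S_mono[OF st(3)] less_imp_le[OF \<omega>_pos[of 0]] by (intro class_KL_mono[OF \<mu>]) auto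
    ultimately show "?\<nu> r t \<le> ?\<nu> r s"
      using G by (intro add_mono mult_left_mono) auto
  qed
  have lim: "(?\<nu> r \<longlongrightarrow> 0) at_top" if r: "0 \<le> r" for r
  proof -
    have "((\<lambda>t. exp (- \<eta> * t)) \<longlongrightarrow> 0) at_top"
      using filterlim_tendsto_pos_mult_at_top[OF tendsto_const \<eta> filterlim_ident]
      by (intro filterlim_compose[OF exp_at_bot]) (simp add: filterlim_uminus_at_top)
    then have 1: "((\<lambda>t. G * exp (- \<eta> * t) * r) \<longlongrightarrow> G * 0 * r) at_top"
      by (intro tendsto_intros)
    have "((\<lambda>t. \<omega> (S t)) \<longlongrightarrow> 0) at_top"
      using \<omega> by (intro filterlim_compose[OF _ S_top]) (simp add: class_L_def)
    then have "((\<lambda>t. \<omega> (S t) * r) \<longlongrightarrow> 0) at_top"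
      by (auto intro: tendsto_mult_left_zero)
    moreover have "continuous_on {0..} (\<lambda>r. \<mu> r 0)" and z: "\<mu> 0 0 = 0"
      using class_KL_fstD[OF \<mu>, of 0] by (auto simp: class_K_infinity_iff)
    ultimately have 2: "((\<lambda>t. \<mu> (\<omega> (S t) * r) 0) \<longlongrightarrow> \<mu> 0 0) at_top"
      using r less_imp_le[OF \<omega>_pos[OF S0]]
      by (intro continuous_on_tendsto_compose[of "{0..}" "\<lambda>r. \<mu> r 0"]) auto
    have "filterlim (\<lambda>t. max 0 (S t - \<tau>)) at_top at_top"
    proof (rule filterlim_at_top_mono)
      show "filterlim (\<lambda>t. S t - \<tau>) at_top at_top"
        by (rule filterlim_tendsto_add_at_top[of "\<lambda>_. -\<tau>" "-\<tau>" _ S, simplified, OF S_top])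
    qed auto
    moreover have "(\<mu> (\<omega> 0 * r) \<longlongrightarrow> 0) at_top"
      using \<mu> r less_imp_le[OF \<omega>_pos[of 0]] by (simp add: class_KL_def)
    ultimately have 3: "((\<lambda>t. \<mu> (\<omega> 0 * r) (max 0 (S t - \<tau>))) \<longlongrightarrow> 0) at_top"
      by (rule filterlim_compose[rotated])
    have "(?\<nu> r \<longlongrightarrow> G * 0 * r + G * (\<mu> 0 0 + 0)) at_top"
      by (intro tendsto_add[OF 1] tendsto_mult[OF tendsto_const] tendsto_add[OF 2 3])
    then show ?thesis
      by (simp add: z)
  qed
  show ?thesis
    unfolding class_KL_def using cont K anti lim by blast
qed

section \<open>Dini derivatives\<close>

lemma upper_right_Dini_lessD:
  assumes "upper_right_Dini y t < ereal c"
  shows "\<exists>\<delta>>0. \<forall>h. 0 < h \<and> h < \<delta> \<longrightarrow> y (t + h) - y t < c * h"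
proof -
  have "eventually (\<lambda>h. ereal ((y (t + h) - y t) / h) < ereal c) (at_right 0)"
    using assms unfolding upper_right_Dini_def by (rule Limsup_lessD)
  then have "\<exists>b>0. \<forall>h>0. h < b \<longrightarrow> (y (t + h) - y t) / h < c"
    by (auto simp: eventually_at_right_field)
  then obtain b where "b > 0" "\<And>h. 0 < h \<Longrightarrow> h < b \<Longrightarrow> (y (t + h) - y t) / h < c"
    by blast
  then show ?thesis
    by (intro exI[of _ b]) (auto simp: pos_divide_less_eq)
qed

lemma upper_right_Dini_leI:
  assumes "\<delta> > 0" and "\<And>h. 0 < h \<Longrightarrow> h < \<delta> \<Longrightarrow> y (t + h) - y t \<le> c * h"
  shows "upper_right_Dini y t \<le> ereal c"
  unfolding upper_right_Dini_def
proof (rule Limsup_bounded)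
  show "eventually (\<lambda>h. ereal ((y (t + h) - y t) / h) \<le> ereal c) (at_right 0)"
    unfolding eventually_at_right_field using assms
    by (auto intro!: exI[of _ \<delta>] simp: divide_le_eq mult.commute)
qed

lemma upper_right_Dini_cong:
  assumes "\<delta> > 0" and "\<And>h. 0 \<le> h \<Longrightarrow> h < \<delta> \<Longrightarrow> y (t + h) = z (s + h)"
  shows "upper_right_Dini y t = upper_right_Dini z s"
  unfolding upper_right_Dini_def
proof (rule Limsup_eq)
  have "y t = z s"
    using assms(2)[of 0] assms(1) by simp
  then show "eventually (\<lambda>h. ereal ((y (t + h) - y t) / h) = ereal ((z (s + h) - z s) / h)) (at_right 0)"
    unfolding eventually_at_right_field using assms by (auto intro!: exI[of _ \<delta>])
qed

text \<open>The last point at which \<open>y\<close> lies on or below the line of slope \<open>c\<close> through \<open>(a, y a)\<close> can only be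
  \<open>b\<close>: from any earlier such point the strict bound on the Dini derivative keeps \<open>y\<close> below the line a
  little longer.\<close>

lemma upper_right_Dini_less_imp_increment_le:
  assumes cont: "continuous_on {a..b} y" and "a \<le> b"
    and Dini: "\<And>t. a \<le> t \<Longrightarrow> t < b \<Longrightarrow> upper_right_Dini y t < ereal c"
  shows "y b - y a \<le> c * (b - a)"
proof -
  define S where "S = {t \<in> {a..b}. y t - y a - c * (t - a) \<le> 0}"
  have "closed ({a..b} \<inter> (\<lambda>t. y t - y a - c * (t - a)) -` {..0})"
    by (intro continuous_closed_preimage continuous_intros cont)
  moreover have "S = {a..b} \<inter> (\<lambda>t. y t - y a - c * (t - a)) -` {..0}"
    by (auto simp: S_def)
  ultimately have "compact S"
    using compact_Int_closed[OF compact_Icc, of "S" a b] by (simp add: Int_absorb1)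
  moreover have "a \<in> S"
    using \<open>a \<le> b\<close> by (simp add: S_def)
  ultimately obtain s where s: "s \<in> S" "\<And>t. t \<in> S \<Longrightarrow> t \<le> s"
    using compact_attains_sup[of S] by auto
  have "s = b"
  proof (rule ccontr)
    assume "s \<noteq> b"
    with s have "a \<le> s" "s < b" by (auto simp: S_def)
    then obtain \<delta> where \<delta>: "\<delta> > 0" "\<And>h. 0 < h \<Longrightarrow> h < \<delta> \<Longrightarrow> y (s + h) - y s < c * h"
      using upper_right_Dini_lessD[OF Dini] by metis
    define h where "h = min (\<delta> / 2) (b - s)"
    have h: "0 < h" "h < \<delta>" "s + h \<le> b"
      using \<delta>(1) \<open>s < b\<close> by (auto simp: h_def)
    have "s + h \<in> S"
      using \<delta>(2)[OF h(1,2)] h s(1) by (auto simp: S_def algebra_simps)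
    with s(2) h(1) show False by force
  qed
  with s(1) show ?thesis by (simp add: S_def)
qed

text \<open>The comparison property speaks about functions on the whole half-line. Beyond \<open>b\<close>, continue \<open>y\<close>
  along the line of slope \<open>-(1 - \<sigma>) \<alpha>(y b)\<close> until it reaches \<open>0\<close>, and by \<open>0\<close> afterwards: since \<open>\<alpha>\<close> is
  increasing and the values stay below \<open>y b\<close>, this slope is steep enough everywhere, so the extended
  function satisfies the differential inequality without solving the equation \<open>y' = -(1 - \<sigma>) \<alpha>(y)\<close>.\<close>

lemma comparison_property_on_interval:
  assumes \<kappa>: "comparison_property \<kappa> \<alpha> \<sigma>" and \<alpha>: "class_K \<infinity> \<alpha>" and \<sigma>: "\<sigma> < 1"
    and cont: "continuous_on {0..b} y" and nonneg: "\<And>t. 0 \<le> t \<Longrightarrow> t \<le> b \<Longrightarrow> 0 \<le> y t"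
    and Dini: "\<And>t. 0 \<le> t \<Longrightarrow> t < b \<Longrightarrow> upper_right_Dini y t \<le> ereal (- (1 - \<sigma>) * \<alpha> (y t))"
    and t: "0 \<le> t" "t \<le> b"
  shows "y t \<le> \<kappa> (y 0) t"
proof -
  have b: "0 \<le> b" using t by simp
  define c where "c = (1 - \<sigma>) * \<alpha> (y b)"
  define l where "l = (\<lambda>t. max 0 (y b - c * (t - b)))"
  define z where "z = (\<lambda>t. if t \<le> b then y t else l t)"
  have c: "0 \<le> c"
    using class_K_nonneg[OF \<alpha> nonneg[OF b]] \<sigma> by (simp add: c_def)
  have lb: "l b = y b"
    using nonneg[OF b] by (simp add: l_def)
  have l_cont: "continuous_on {b..} l"
    unfolding l_def by (intro continuous_intros)
  have z_cont: "continuous_on {0..} z"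
  proof -
    have "continuous_on ({0..b} \<union> {b..}) z"
      unfolding z_def by (rule continuous_on_cases) (use cont l_cont lb in auto)
    moreover have "{0..b} \<union> {b..} = {0..}" using b by auto
    ultimately show ?thesis by simp
  qed
  have z_nonneg: "0 \<le> z s" if "0 \<le> s" for s
    using nonneg that by (simp add: z_def l_def)
  have z_Dini: "upper_right_Dini z s \<le> ereal (- (1 - \<sigma>) * \<alpha> (z s))" if s: "0 \<le> s" for s
  proof (cases "s < b")
    case True
    have "upper_right_Dini z s = upper_right_Dini y s"
      by (rule upper_right_Dini_cong[of "b - s"]) (use True in \<open>auto simp: z_def\<close>)
    with Dini[OF s True] True show ?thesis by (simp add: z_def)
  next
    case False
    then have zs: "z (s + h) = l (s + h)" if "0 \<le> h" for h
      using that lb by (cases "s + h = b") (auto simp: z_def)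
    have zs0: "z s = l s"
      using zs[of 0] by simp
    show ?thesis
    proof (cases "l s = 0")
      case True
      have "z (s + h) - z s \<le> - (1 - \<sigma>) * \<alpha> (z s) * h" if "0 < h" for h
      proof -
        have "l (s + h) \<le> l s"
          using mult_left_mono[OF _ c, of "s - b" "s + h - b"] that
          by (simp add: l_def max.coboundedI2)
        moreover have "0 \<le> l (s + h)" by (simp add: l_def)
        ultimately have "l (s + h) = 0" using True by simp
        moreover have "\<alpha> 0 = 0" using \<alpha> by (simp add: class_K_infinity_iff)
        ultimately show ?thesis
          using zs[of h] that zs0 True by simp
      qed
      then show ?thesis
        by (intro upper_right_Dini_leI[of 1]) auto
    next
      case False2: False
      then have ls: "l s = y b - c * (s - b)" "0 < l s"
        by (auto simp: l_def max_def split: if_splits)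
      have "l s \<le> y b"
        using ls c False by simp
      then have "\<alpha> (l s) \<le> \<alpha> (y b)"
        using class_K_mono[OF \<alpha>] ls(2) by simp
      then have "(1 - \<sigma>) * \<alpha> (z s) \<le> c"
        using \<sigma> by (auto simp: c_def zs0 intro!: mult_left_mono)
      then have rate: "- c * h \<le> - (1 - \<sigma>) * \<alpha> (z s) * h" if "0 < h" for h
        using mult_right_mono[of "(1 - \<sigma>) * \<alpha> (z s)" c h] that by (simp add: algebra_simps)
      \<comment> \<open>the line stays positive for a time \<open>l s / c\<close>; \<open>c + 1\<close> avoids division by zero\<close>
      have "\<exists>\<delta>>0. \<forall>h. 0 < h \<and> h < \<delta> \<longrightarrow> z (s + h) - z s \<le> - c * h"
      proof (intro exI[of _ "l s / (c + 1)"] conjI allI impI)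
        show "0 < l s / (c + 1)" using ls(2) c by simp
        fix h assume h: "0 < h \<and> h < l s / (c + 1)"
        then have "h * (c + 1) < l s"
          using c by (simp add: pos_less_divide_eq)
        then have "0 \<le> l s - c * h"
          using h by (simp add: algebra_simps)
        then show "z (s + h) - z s \<le> - c * h"
          using h zs[of h] zs0 ls(1) by (simp add: l_def algebra_simps)
      qed
      then obtain \<delta> where \<delta>: "\<delta> > 0" "\<And>h. 0 < h \<Longrightarrow> h < \<delta> \<Longrightarrow> z (s + h) - z s \<le> - c * h"
        by blast
      show ?thesis
        by (rule upper_right_Dini_leI[OF \<delta>(1)]) (rule order_trans[OF \<delta>(2) rate])
    qed
  qed
  have "z t \<le> \<kappa> (z 0) t"
    using \<kappa> z_cont z_nonneg z_Dini t unfolding comparison_property_def by blast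
  with t b show ?thesis by (simp add: z_def)
qed

section \<open>Switching times with a dwell time\<close>

text \<open>The values are extended reals: \<open>t j = \<infinity>\<close> means that there are fewer than \<open>j\<close> switches after time \<open>0\<close>.\<close>

definition switching_times :: "real \<Rightarrow> (nat \<Rightarrow> ereal) \<Rightarrow> bool" where
  "switching_times \<tau> t \<longleftrightarrow> 0 < \<tau> \<and> t 0 = 0 \<and> (\<forall>j. t j + ereal \<tau> \<le> t (Suc j))"

lemma switching_times_ge:
  assumes t: "switching_times \<tau> t"
  shows "ereal (real j * \<tau>) \<le> t j"
proof (induction j)
  case 0
  then show ?case
    using t by (simp add: switching_times_def)
next
  case (Suc j)
  have "ereal (real (Suc j) * \<tau>) = ereal (real j * \<tau>) + ereal \<tau>"
    by (simp add: algebra_simps)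
  also have "\<dots> \<le> t j + ereal \<tau>"
    by (intro add_mono Suc order_refl)
  also have "\<dots> \<le> t (Suc j)"
    using t by (simp add: switching_times_def)
  finally show ?case .
qed

lemma switching_times_mono:
  assumes t: "switching_times \<tau> t" and "i \<le> j"
  shows "t i \<le> t j"
proof (rule lift_Suc_mono_le[OF _ \<open>i \<le> j\<close>])
  fix j
  have "t j \<le> t j + ereal \<tau>"
    using t by (simp add: switching_times_def ereal_le_add_self)
  also have "\<dots> \<le> t (Suc j)"
    using t by (simp add: switching_times_def)
  finally show "t j \<le> t (Suc j)" .
qed

lemma switching_index_unique:
  assumes t: "switching_times \<tau> t"
    and "t i \<le> s" "s < t (Suc i)" "t j \<le> s" "s < t (Suc j)"
  shows "i = j"
proof (rule ccontr)
  have *: "t (Suc i) \<le> t j" if "i < j" for i j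
    using that by (intro switching_times_mono[OF t]) auto
  assume "i \<noteq> j"
  then consider "i < j" | "j < i" by linarith
  then show False
    using *[of i j] *[of j i] assms(2-5) by cases auto
qed

text \<open>The dwell time excludes an accumulation of switching times.\<close>

lemma switching_index_exists:
  assumes t: "switching_times \<tau> t" and s: "0 \<le> s"
  shows "\<exists>j. t j \<le> ereal s \<and> ereal s < t (Suc j)"
proof -
  define k where "k = (LEAST j. ereal s < t (Suc j))"
  obtain n :: nat where "s / \<tau> < real n"
    using reals_Archimedean2 by blast
  then have "ereal s < ereal (real (Suc n) * \<tau>)"
    using t by (simp add: switching_times_def pos_divide_less_eq algebra_simps)
  also have "\<dots> \<le> t (Suc n)"
    by (rule switching_times_ge[OF t])
  finally have k: "ereal s < t (Suc k)"
    unfolding k_def by (rule LeastI)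
  have "t k \<le> ereal s"
  proof (cases k)
    case 0
    then show ?thesis using t s by (simp add: switching_times_def)
  next
    case (Suc j)
    then show ?thesis
      using not_less_Least[of j "\<lambda>j. ereal s < t (Suc j)"] by (simp add: k_def)
  qed
  with k show ?thesis by blast
qed

section \<open>From the iterates to a class KL bound\<close>

lemma rho_nonneg:
  assumes \<psi>1: "class_K_inf \<psi>1" and \<psi>2: "class_K_inf \<psi>2" and \<kappa>: "class_KL \<kappa>"
    and "0 \<le> G" "0 \<le> m" "0 \<le> n"
  shows "0 \<le> rho \<psi>1 \<psi>2 \<kappa> G \<eta> \<tau> m n"
proof -
  have "0 \<le> \<psi>2 (G * exp (- \<eta> * \<tau>) * m)"
    by (rule class_K_nonneg) (use assms in \<open>simp_all add: class_K_inf_def\<close>)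
  then show ?thesis
    unfolding rho_def using class_K_inf_inverse(1)[OF \<psi>1 class_KL_nonneg[OF \<kappa> _ \<open>0 \<le> n\<close>]] by blast
qed

lemma rho_mono:
  assumes \<psi>1: "class_K_inf \<psi>1" and \<psi>2: "class_K_inf \<psi>2" and \<kappa>: "class_KL \<kappa>"
    and "0 \<le> G" "0 \<le> m" "m \<le> m'" "0 \<le> n"
  shows "rho \<psi>1 \<psi>2 \<kappa> G \<eta> \<tau> m n \<le> rho \<psi>1 \<psi>2 \<kappa> G \<eta> \<tau> m' n"
proof -
  let ?c = "G * exp (- \<eta> * \<tau>)"
  have \<psi>2': "class_K \<infinity> \<psi>2"
    using \<psi>2 by (simp add: class_K_inf_def)
  have "0 \<le> ?c * m" "?c * m \<le> ?c * m'"
    using assms by (auto intro: mult_left_mono)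
  then have "0 \<le> \<psi>2 (?c * m)" "\<psi>2 (?c * m) \<le> \<psi>2 (?c * m')"
    using class_K_nonneg[OF \<psi>2'] class_K_mono[OF \<psi>2'] by auto
  then have "0 \<le> \<kappa> (\<psi>2 (?c * m)) n" "\<kappa> (\<psi>2 (?c * m)) n \<le> \<kappa> (\<psi>2 (?c * m')) n"
    using class_KL_nonneg[OF \<kappa>] class_KL_mono[OF \<kappa>] \<open>0 \<le> n\<close> by auto
  then show ?thesis
    unfolding rho_def
    using class_K_inf_le_inverse[OF \<psi>1] class_K_inf_inverse[OF \<psi>1] by simp
qed

lemma iterate_R_cong:
  "(\<And>j. j \<in> {1..K} \<Longrightarrow> n j = n' j) \<Longrightarrow> iterate_R \<rho> K m n = iterate_R \<rho> K m n'"
  by (induction K) simp_all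

text \<open>Monotonicity of \<open>\<rho>\<close> turns the estimates of the single rounds into \<open>\<parallel>x(t\<^sub>j)\<parallel> \<le> R\<^sup>(\<^sup>j\<^sup>)(\<parallel>x(0)\<parallel>, n)\<close>, where
  \<open>n\<^sub>i = t\<^sub>i - t\<^sub>i\<^sub>-\<^sub>1 - \<tau>\<close>. A time \<open>s\<close> in the round that starts at \<open>t\<^sub>j\<close> lies either in its dwell interval, where
  the \<open>j\<close> completed rounds supply the bound and the factor \<open>G\<close> absorbs the dwell interval, or after it,
  where the unfinished round counts as the \<open>(j + 1)\<close>-st with gap \<open>s - t\<^sub>j - \<tau>\<close>.\<close>

lemma norm_le_KL_bound_of_iterates:
  fixes x :: "real \<Rightarrow> 'a::real_normed_vector" and t :: "nat \<Rightarrow> ereal"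
  assumes t: "switching_times \<tau> t" and G: "1 \<le> G" and \<eta>: "0 < \<eta>"
    and \<rho>_nonneg: "\<And>m n. 0 \<le> m \<Longrightarrow> 0 \<le> n \<Longrightarrow> 0 \<le> \<rho> m n"
    and \<rho>_mono: "\<And>m m' n. 0 \<le> m \<Longrightarrow> m \<le> m' \<Longrightarrow> 0 \<le> n \<Longrightarrow> \<rho> m n \<le> \<rho> m' n"
    and dwell: "\<And>j a s. t j = ereal a \<Longrightarrow> 0 \<le> s \<Longrightarrow> s \<le> \<tau> \<Longrightarrow> norm (x (a + s)) \<le> G * exp (- \<eta> * s) * norm (x a)"
    and decay: "\<And>j a b. t j = ereal a \<Longrightarrow> 0 \<le> b \<Longrightarrow> ereal (a + \<tau> + b) \<le> t (Suc j) \<Longrightarrow>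
      norm (x (a + \<tau> + b)) \<le> \<rho> (norm (x a)) b"
    and \<mu>: "class_KL \<mu>" and \<omega>: "class_L \<omega>"
    and iterates: "\<And>K m n. 1 \<le> K \<Longrightarrow> 0 \<le> m \<Longrightarrow> (\<And>j. j \<in> {1..K} \<Longrightarrow> 0 \<le> n j) \<Longrightarrow>
      iterate_R \<rho> K m n \<le> \<mu> (\<omega> (real K) * m) (Max (n ` {1..K}))"
    and s: "0 \<le> s"
  defines "S \<equiv> sqrt (max 0 (s - \<tau>))"
  shows "norm (x s) \<le> G * exp (- \<eta> * s) * norm (x 0) +
    G * (\<mu> (\<omega> S * norm (x 0)) 0 + \<mu> (\<omega> 0 * norm (x 0)) (max 0 (S - \<tau>)))"
proof -
  let ?r = "norm (x 0)"
  let ?Q = "\<mu> (\<omega> S * ?r) 0 + \<mu> (\<omega> 0 * ?r) (max 0 (S - \<tau>))"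
  have \<tau>: "0 < \<tau>" and t0: "t 0 = 0" and t\<tau>: "t j + ereal \<tau> \<le> t (Suc j)" for j
    using t by (simp_all add: switching_times_def)
  define n where "n = (\<lambda>j. real_of_ereal (t j) - real_of_ereal (t (j - 1)) - \<tau>)"
  have prev: "\<exists>a. t j = ereal a \<and> 0 \<le> n (Suc j) \<and> a' = a + \<tau> + n (Suc j)" if "t (Suc j) = ereal a'" for j a'
    using t\<tau>[of j] switching_times_mono[OF t, of 0 j] that t0
    by (cases "t j") (auto simp: n_def)
  have gaps: "0 \<le> n i" if "t j = ereal a" "i \<in> {1..j}" for i j a
  proof -
    obtain i' where i': "i = Suc i'"
      using \<open>i \<in> {1..j}\<close> by (cases i) auto
    have "0 \<le> t i" "t i \<le> ereal a"
      using switching_times_mono[OF t, of i j] switching_times_mono[OF t, of 0 i] t0 that by auto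
    then show ?thesis
      using prev[of i'] unfolding i' by (cases "t (Suc i')") auto
  qed
  have iter: "norm (x a) \<le> iterate_R \<rho> j ?r n" if "t j = ereal a" for j a
    using that
  proof (induction j arbitrary: a)
    case 0
    then show ?case using t0 by simp
  next
    case (Suc j)
    then obtain a0 where a0: "t j = ereal a0" "0 \<le> n (Suc j)" "a = a0 + \<tau> + n (Suc j)"
      using prev by blast
    have "norm (x a) \<le> \<rho> (norm (x a0)) (n (Suc j))"
      using decay[OF a0(1,2)] Suc.prems a0(3) by simp
    also have "\<dots> \<le> \<rho> (iterate_R \<rho> j ?r n) (n (Suc j))"
      by (intro \<rho>_mono Suc.IH a0) simp
    finally show ?case by simp
  qed
  \<comment> \<open>each of the \<open>j\<close> rounds consists of a dwell interval of length \<open>\<tau>\<close> and a gap of at most \<open>N\<close>\<close>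
  have length: "a \<le> real j * (\<tau> + N)" if "t j = ereal a" "\<And>i. i \<in> {1..j} \<Longrightarrow> n i \<le> N" for j a N
    using that
  proof (induction j arbitrary: a)
    case 0
    then show ?case using t0 by simp
  next
    case (Suc j)
    then obtain a0 where a0: "t j = ereal a0" "a = a0 + \<tau> + n (Suc j)"
      using prev by blast
    have "a0 \<le> real j * (\<tau> + N)"
      using Suc.prems by (intro Suc.IH a0) auto
    moreover have "n (Suc j) \<le> N"
      using Suc.prems by simp
    ultimately show ?case
      using a0(2) by (simp add: algebra_simps)
  qed
  have Q: "\<mu> (\<omega> (real K) * ?r) N \<le> ?Q" if "s - \<tau> \<le> real K * (\<tau> + N)" "0 \<le> N" for K N
    unfolding S_def using that \<tau> by (intro KL_bound_of_count_and_gap[OF \<mu> \<omega>]) auto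
  have Q_nonneg: "0 \<le> ?Q"
    using less_imp_le[OF class_L_pos[OF \<omega>, of S]] less_imp_le[OF class_L_pos[OF \<omega>, of 0]]
    by (intro add_nonneg_nonneg class_KL_nonneg[OF \<mu>]) (auto simp: S_def)
  have GQ: "?Q \<le> G * ?Q"
    using mult_right_mono[OF G Q_nonneg] by simp
  have first: "0 \<le> G * exp (- \<eta> * s) * ?r"
    using G by simp
  obtain j where j: "t j \<le> ereal s" "ereal s < t (Suc j)"
    using switching_index_exists[OF t s] by blast
  obtain a where a: "t j = ereal a" "0 \<le> a" "a \<le> s"
    using j switching_times_mono[OF t, of 0 j] t0 by (cases "t j") auto
  show ?thesis
  proof (cases "s \<le> a + \<tau>")
    case True
    have dw: "norm (x s) \<le> G * exp (- \<eta> * (s - a)) * norm (x a)"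
      using dwell[OF a(1), of "s - a"] a True by simp
    show ?thesis
    proof (cases "j = 0")
      case True
      then have "a = 0" using a(1) t0 by simp
      moreover have "0 \<le> G * ?Q"
        using Q_nonneg GQ by linarith
      ultimately show ?thesis
        using dw by simp
    next
      case False
      define N where "N = Max (n ` {1..j})"
      have N: "n i \<le> N" if "i \<in> {1..j}" for i
        unfolding N_def using that by (intro Max_ge) auto
      have "0 \<le> N"
        using N[of 1] gaps[OF a(1), of 1] False by (auto simp: Suc_le_eq intro: order_trans)
      moreover have "s - \<tau> \<le> real j * (\<tau> + N)"
        using length[OF a(1) N] True by simp
      ultimately have "\<mu> (\<omega> (real j) * ?r) N \<le> ?Q"
        by (intro Q)
      moreover have "iterate_R \<rho> j ?r n \<le> \<mu> (\<omega> (real j) * ?r) N"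
        unfolding N_def using False gaps[OF a(1)] by (intro iterates) auto
      ultimately have xa: "norm (x a) \<le> ?Q"
        using iter[OF a(1)] by linarith
      have "G * exp (- \<eta> * (s - a)) \<le> G"
        using G \<eta> a(3) by simp
      then have "norm (x s) \<le> G * ?Q"
        using G by (intro order_trans[OF dw] mult_mono[OF _ xa]) simp_all
      with first show ?thesis by linarith
    qed
  next
    case False
    define b where "b = s - a - \<tau>"
    define n' where "n' = n(Suc j := b)"
    define N where "N = Max (n' ` {1..Suc j})"
    have b: "0 \<le> b" "s = a + \<tau> + b"
      using False by (simp_all add: b_def)
    have N: "n' i \<le> N" if "i \<in> {1..Suc j}" for i
      unfolding N_def using that by (intro Max_ge) auto
    have n'_nonneg: "0 \<le> n' i" if "i \<in> {1..Suc j}" for i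
      using gaps[OF a(1), of i] that b(1) by (auto simp: n'_def)
    have "b \<le> N"
      using N[of "Suc j"] by (simp add: n'_def)
    have "a \<le> real j * (\<tau> + N)"
      by (rule length[OF a(1)]) (use N in \<open>force simp: n'_def\<close>)
    then have "s - \<tau> \<le> real (Suc j) * (\<tau> + N)"
      using \<open>b \<le> N\<close> b(2) \<tau> by (simp add: algebra_simps)
    then have bound: "\<mu> (\<omega> (real (Suc j)) * ?r) N \<le> ?Q"
      using \<open>b \<le> N\<close> b(1) by (intro Q) auto
    have "norm (x s) \<le> \<rho> (norm (x a)) b"
      using decay[OF a(1) b(1)] j(2) b(2) by simp
    also have "\<dots> \<le> \<rho> (iterate_R \<rho> j ?r n) b"
      by (intro \<rho>_mono iter[OF a(1)] b) simp
    also have "iterate_R \<rho> j ?r n = iterate_R \<rho> j ?r n'"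
      by (intro iterate_R_cong) (simp add: n'_def)
    also have "\<rho> \<dots> b = iterate_R \<rho> (Suc j) ?r n'"
      by (simp add: n'_def)
    also have "\<dots> \<le> \<mu> (\<omega> (real (Suc j)) * ?r) N"
      unfolding N_def by (intro iterates n'_nonneg) auto
    also note bound
    finally show ?thesis
      using GQ first by linarith
  qed
qed

section \<open>The flow under a constant input\<close>

lemma continuous_on_atLeastI:
  fixes g :: "real \<Rightarrow> 'a::topological_space"
  assumes "\<And>b. continuous_on {a..b} g"
  shows "continuous_on {a..} g"
  unfolding continuous_on_eq_continuous_within
proof
  fix x assume "x \<in> {a..}"
  then have "continuous (at x within {a..x + 1}) g"
    using assms[of "x + 1"] by (simp add: continuous_on_eq_continuous_within)
  moreover have "at x within {a..x + 1} = at x within {a..}"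
    by (rule at_within_nhd[of x "{..<x + 1}"]) auto
  ultimately show "continuous (at x within {a..}) g"
    by (simp add: continuous_within)
qed

lemma coercive_ISS_LyapunovD:
  assumes "coercive_ISS_Lyapunov T B f F V \<psi>1 \<psi>2 \<alpha> \<gamma>"
  shows "continuous_on UNIV V" "0 \<le> V x" "class_K_inf \<psi>1" "class_K_inf \<psi>2"
    "class_K \<infinity> \<alpha>" "class_K \<infinity> \<gamma>" "\<psi>1 (norm x) \<le> V x" "V x \<le> \<psi>2 (norm x)"
    "d \<in> disturbances \<Longrightarrow> mild_solution T (\<lambda>s. B (f (F (\<phi> s))) + d s) x \<phi> \<Longrightarrow>
      Limsup (at_right 0) (\<lambda>h. ereal ((V (\<phi> h) - V x) / h)) \<le> ereal (- \<alpha> (V x) + \<gamma> (norm (d 0)))"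
  using assms by (auto simp: coercive_ISS_Lyapunov_def class_K_inf_def)

locale exp_bounded_semigroup =
  fixes T :: "real \<Rightarrow> 'h::banach \<Rightarrow>\<^sub>L 'h" and M \<nu> :: real
  assumes semigroup: "C0_semigroup T"
    and M_ge_1: "1 \<le> M" and \<nu>_pos: "0 < \<nu>"
    and norm_T: "0 \<le> t \<Longrightarrow> norm (T t) \<le> M * exp (\<nu> * t)"
begin

lemma T_0 [simp]: "T 0 p = p"
  using semigroup by (simp add: C0_semigroup_def)

lemma T_add: "0 \<le> s \<Longrightarrow> 0 \<le> t \<Longrightarrow> T (s + t) p = T s (T t p)"
  using semigroup by (simp add: C0_semigroup_def)

lemma norm_T_apply_le:
  assumes "0 \<le> t" "t \<le> b"
  shows "norm (T t p) \<le> M * exp (\<nu> * b) * norm p"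
proof -
  have "norm (T t p) \<le> norm (T t) * norm p"
    by (rule norm_blinfun)
  also have "\<dots> \<le> (M * exp (\<nu> * b)) * norm p"
    using norm_T[OF assms(1)] assms M_ge_1 \<nu>_pos
    by (intro mult_right_mono order_trans[OF norm_T[OF assms(1)]] mult_left_mono) auto
  finally show ?thesis .
qed

text \<open>Factoring out the earlier operator gives one estimate that serves for continuity from the right
  and, because of the uniform bound on \<open>[0, b]\<close>, also from the left.\<close>

lemma norm_T_diff_le:
  assumes "0 \<le> s" "s \<le> t" "t \<le> b"
  shows "norm (T t p - T s p) \<le> M * exp (\<nu> * b) * norm (T (t - s) p - p)"
proof -
  have "T t p - T s p = T s (T (t - s) p - p)"
    using T_add[of s "t - s" p] assms by (simp add: blinfun.diff_right)
  then show ?thesis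
    using norm_T_apply_le[of s b "T (t - s) p - p"] assms by simp
qed

lemma T_continuous: "continuous_on {0..} (\<lambda>t. T t p)"
  unfolding continuous_on_iff
proof (intro ballI allI impI)
  fix t e :: real assume t: "t \<in> {0..}" and e: "0 < e"
  define C where "C = M * exp (\<nu> * (t + 1))"
  have C: "0 < C" using M_ge_1 by (simp add: C_def)
  have "((\<lambda>t. T t p) \<longlongrightarrow> p) (at_right 0)"
    using semigroup by (simp add: C0_semigroup_def)
  then have "eventually (\<lambda>h. dist (T h p) p < e / C) (at_right 0)"
    using e C by (intro tendstoD) auto
  then obtain \<delta> where \<delta>: "\<delta> > 0" "\<And>h. 0 < h \<Longrightarrow> h < \<delta> \<Longrightarrow> dist (T h p) p < e / C"
    by (auto simp: eventually_at_right_field)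
  have \<delta>': "C * norm (T h p - p) < e" if "0 \<le> h" "h < \<delta>" for h
    using that \<delta>(2)[of h] C e
    by (cases "h = 0") (auto simp: dist_norm pos_less_divide_eq mult.commute)
  have "dist (T s p) (T t p) < e" if s: "s \<in> {0..}" "dist s t < min 1 \<delta>" for s
  proof (cases "s \<le> t")
    case True
    then have "norm (T t p - T s p) \<le> C * norm (T (t - s) p - p)"
      unfolding C_def using s by (intro norm_T_diff_le) (auto simp: dist_real_def)
    also have "\<dots> < e"
      using s True by (intro \<delta>') (auto simp: dist_real_def)
    finally show ?thesis by (simp add: dist_norm norm_minus_commute)
  next
    case False
    then have "norm (T s p - T t p) \<le> C * norm (T (s - t) p - p)"
      unfolding C_def using s t by (intro norm_T_diff_le) (auto simp: dist_real_def)
    also have "\<dots> < e"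
      using s False by (intro \<delta>') (auto simp: dist_real_def)
    finally show ?thesis by (simp add: dist_norm)
  qed
  with \<delta>(1) show "\<exists>d>0. \<forall>s\<in>{0..}. dist s t < d \<longrightarrow> dist (T s p) (T t p) < e"
    by (intro exI[of _ "min 1 \<delta>"]) auto
qed

lemma T_integrable: "0 \<le> a \<Longrightarrow> (\<lambda>r. T r p) integrable_on {a..b}"
  by (intro integrable_continuous_real continuous_on_subset[OF T_continuous]) auto

lemma norm_integral_T_le:
  assumes "0 \<le> a" "a \<le> b" "b \<le> c"
  shows "norm (integral {a..b} (\<lambda>r. T r p)) \<le> M * exp (\<nu> * c) * norm p * (b - a)"
  using assms by (intro integral_bound continuous_on_subset[OF T_continuous] norm_T_apply_le) auto

text \<open>The mild solution of \<open>x' = A x + w\<close>, \<open>x(0) = p\<close> for a constant \<open>w\<close>; integrating \<open>T r w\<close> instead of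
  \<open>T (t - r) w\<close> makes its regularity in \<open>t\<close> that of an indefinite integral.\<close>

definition flow :: "'h \<Rightarrow> 'h \<Rightarrow> real \<Rightarrow> 'h" where
  "flow p w t = T t p + integral {0..t} (\<lambda>r. T r w)"

lemma flow_0 [simp]: "flow p w 0 = p"
  by (simp add: flow_def)

lemma integral_T_diff:
  assumes "0 \<le> s" "s \<le> t"
  shows "integral {0..t} (\<lambda>r. T r p) - integral {0..s} (\<lambda>r. T r p) = integral {s..t} (\<lambda>r. T r p)"
  using Henstock_Kurzweil_Integration.integral_combine[OF assms T_integrable[of 0 p t]] by (simp add: algebra_simps)

lemma integral_T_lipschitz: "\<exists>L. L-lipschitz_on {0..b} (\<lambda>t. integral {0..t} (\<lambda>r. T r p))"
proof (cases "0 \<le> b")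
  case True
  let ?I = "\<lambda>t. integral {0..t} (\<lambda>r. T r p)" and ?L = "M * exp (\<nu> * b) * norm p"
  have *: "dist (?I t) (?I s) \<le> ?L * dist t s" if "0 \<le> s" "s \<le> t" "t \<le> b" for s t
    using norm_integral_T_le[of s t b p] integral_T_diff[OF that(1,2), of p] that
    by (simp add: dist_norm)
  have "?L-lipschitz_on {0..b} ?I"
  proof (rule lipschitz_onI)
    fix s t assume "s \<in> {0..b}" "t \<in> {0..b}"
    then show "dist (?I s) (?I t) \<le> ?L * dist s t"
      using *[of s t] *[of t s] by (cases "s \<le> t") (auto simp: dist_commute)
  qed (use M_ge_1 in simp)
  then show ?thesis ..
qed (auto intro!: exI[of _ 0] lipschitz_onI)

lemma integral_T_continuous: "continuous_on {0..} (\<lambda>t. integral {0..t} (\<lambda>r. T r p))"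
proof -
  have "continuous_on {0..b} (\<lambda>t. integral {0..t} (\<lambda>r. T r p))" for b
    by (intro indefinite_integral_continuous_1 T_integrable order_refl)
  then show ?thesis
    by (rule continuous_on_atLeastI)
qed

lemma flow_continuous: "continuous_on {0..} (flow p w)"
  unfolding flow_def by (intro continuous_intros T_continuous integral_T_continuous)

lemma flow_add:
  assumes "0 \<le> s" "0 \<le> h"
  shows "flow (flow p w s) w h = flow p w (s + h)"
proof -
  have "T h (integral {0..s} (\<lambda>r. T r w)) = integral {0..s} (\<lambda>r. T h (T r w))"
    using integral_linear[OF T_integrable[OF order_refl, of w s] blinfun.bounded_linear_right[of "T h"]]
    by (simp add: o_def)
  also have "\<dots> = integral {0..s} ((\<lambda>r. T r w) \<circ> (+) h)"
    using assms T_add[of h _ w] by (intro integral_cong) simp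
  also have "\<dots> = integral {h..s + h} (\<lambda>r. T r w)"
    using integral_shift_Icc_real[of 0 s "\<lambda>r. T r w" h] by simp
  also have "\<dots> = integral {0..s + h} (\<lambda>r. T r w) - integral {0..h} (\<lambda>r. T r w)"
    using integral_T_diff[of h "s + h" w] assms by simp
  finally show ?thesis
    using T_add[of h s p] assms by (simp add: flow_def blinfun.add_right add.commute)
qed

lemma flow_has_integral:
  assumes "a \<le> t"
  shows "((\<lambda>s. T (t - s) w) has_integral (flow p w (t - a) - T (t - a) p)) {a..t}"
proof -
  have "((\<lambda>r. T r w) has_integral (flow p w (t - a) - T (t - a) p)) (cbox 0 (t - a))"
    using integrable_integral[OF T_integrable[OF order_refl, of w "t - a"]] by (simp add: flow_def)
  from has_integral_affinity[OF this, of "-1" t]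
  have "((\<lambda>s. T (t - s) w) has_integral (flow p w (t - a) - T (t - a) p)) ((\<lambda>x. t - x) ` {0..t - a})"
    by simp
  then show ?thesis
    by simp
qed

lemma mild_solution_flow: "mild_solution T (\<lambda>_. w) p (flow p w)"
  unfolding mild_solution_def using flow_continuous flow_has_integral[of 0 _ w p] by simp

lemma norm_flow_diff_le:
  assumes "0 \<le> t" "t \<le> b"
  shows "norm (flow q w t - flow p w t) \<le> M * exp (\<nu> * b) * norm (q - p)"
  using norm_T_apply_le[OF assms, of "q - p"] by (simp add: flow_def blinfun.diff_right)

text \<open>The averages \<open>(1/\<delta>) \<integral>\<^sub>0\<^sup>\<delta> T(r) p dr\<close> converge to \<open>p\<close> as \<open>\<delta> \<rightarrow> 0\<close>, and \<open>T(t)\<close> maps such an average to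
  \<open>(1/\<delta>) \<integral>\<^sub>t\<^sup>t\<^sup>+\<^sup>\<delta> T(r) p dr\<close>, which is locally Lipschitz in \<open>t\<close> since the integrand is locally bounded.\<close>

lemma lipschitz_orbits_dense:
  assumes "0 < e"
  shows "\<exists>q. norm (q - p) < e \<and> (\<forall>b. \<exists>L. L-lipschitz_on {0..b} (\<lambda>t. T t q))"
proof -
  let ?I = "\<lambda>t. integral {0..t} (\<lambda>r. T r p)"
  have "((\<lambda>t. T t p) \<longlongrightarrow> p) (at_right 0)"
    using semigroup by (simp add: C0_semigroup_def)
  then have "eventually (\<lambda>h. dist (T h p) p < e / 2) (at_right 0)"
    using assms by (intro tendstoD) auto
  then obtain \<delta>0 where \<delta>0: "\<delta>0 > 0" "\<And>h. 0 < h \<Longrightarrow> h < \<delta>0 \<Longrightarrow> dist (T h p) p < e / 2"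
    by (auto simp: eventually_at_right_field)
  define \<delta> where "\<delta> = \<delta>0 / 2"
  have \<delta>: "0 < \<delta>" using \<delta>0(1) by (simp add: \<delta>_def)
  have near: "norm (T h p - p) \<le> e / 2" if "h \<in> {0..\<delta>}" for h
    using \<delta>0 that assms by (cases "h = 0") (auto simp: \<delta>_def dist_norm intro!: less_imp_le)
  define q where "q = ?I \<delta> /\<^sub>R \<delta>"
  have "?I \<delta> - \<delta> *\<^sub>R p = integral {0..\<delta>} (\<lambda>r. T r p - p)"
    using \<delta> by (subst Henstock_Kurzweil_Integration.integral_diff) (auto simp: T_integrable)
  also have "norm \<dots> \<le> e / 2 * (\<delta> - 0)"
    using near \<delta> by (intro integral_bound continuous_intros continuous_on_subset[OF T_continuous]) auto
  also have "\<dots> < e * \<delta>"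
    using \<delta> assms by simp
  finally have "norm (?I \<delta> - \<delta> *\<^sub>R p) / \<delta> < e"
    using \<delta> by (simp add: pos_divide_less_eq)
  moreover have "q - p = (?I \<delta> - \<delta> *\<^sub>R p) /\<^sub>R \<delta>"
    using \<delta> by (simp add: q_def scaleR_diff_right)
  ultimately have "norm (q - p) < e"
    using \<delta> by (simp add: divide_inverse mult.commute)
  moreover have "\<exists>L. L-lipschitz_on {0..b} (\<lambda>t. T t q)" for b
  proof -
    have T_q: "T t q = (?I (\<delta> + t) - ?I t) /\<^sub>R \<delta>" if "0 \<le> t" for t
    proof -
      have "T t (?I \<delta>) = ?I (\<delta> + t) - ?I t"
        using flow_add[of \<delta> t 0 p] that \<delta> by (simp add: flow_def blinfun.zero_right algebra_simps)
      then show ?thesis by (simp add: q_def blinfun.scaleR_right)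
    qed
    obtain L where L: "L-lipschitz_on {0..\<delta> + b} ?I"
      using integral_T_lipschitz by blast
    have "1-lipschitz_on {0..b} (\<lambda>t. \<delta> + t)"
      by (intro lipschitz_onI) auto
    moreover have "L-lipschitz_on ((\<lambda>t. \<delta> + t) ` {0..b}) ?I"
      by (rule lipschitz_on_subset[OF L]) (use \<delta> in auto)
    ultimately have "(L * 1)-lipschitz_on {0..b} (?I \<circ> (\<lambda>t. \<delta> + t))"
      by (intro lipschitz_on_compose)
    moreover have "L-lipschitz_on {0..b} ?I"
      by (rule lipschitz_on_subset[OF L]) (use \<delta> in auto)
    ultimately have "(L * 1 + L)-lipschitz_on {0..b} (\<lambda>t. (?I \<circ> (\<lambda>t. \<delta> + t)) t - ?I t)"
      by (rule lipschitz_on_diff)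
    then have "(\<bar>inverse \<delta>\<bar> * (L * 1 + L))-lipschitz_on {0..b} (\<lambda>t. inverse \<delta> *\<^sub>R ((?I \<circ> (\<lambda>t. \<delta> + t)) t - ?I t))"
      by (rule lipschitz_on_cmult)
    then have "(\<bar>inverse \<delta>\<bar> * (L * 1 + L))-lipschitz_on {0..b} (\<lambda>t. T t q)"
      by (rule lipschitz_on_transform) (auto simp: T_q)
    then show ?thesis ..
  qed
  ultimately show ?thesis by blast
qed

section \<open>Decrease of the Lyapunov function under a constant input\<close>

text \<open>The flow with constant input \<open>w\<close> solves the disturbed system for the disturbance
  \<open>w - B f(F x)\<close>. It is Lipschitz in time for this initial value, hence so is the disturbance.\<close>

lemma Dini_Lyapunov_flow_lipschitz_orbit:
  assumes V: "coercive_ISS_Lyapunov T B f F V \<psi>1 \<psi>2 \<alpha> \<gamma>"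
    and f: "\<exists>L. L-lipschitz_on UNIV (\<lambda>x. f (F x))"
    and q: "\<And>b. \<exists>L. L-lipschitz_on {0..b} (\<lambda>t. T t q)" and t: "0 \<le> t"
  shows "upper_right_Dini (\<lambda>t. V (flow q w t)) t
    \<le> ereal (- \<alpha> (V (flow q w t)) + \<gamma> (norm (w - B (f (F (flow q w t))))))"
proof -
  let ?\<phi> = "flow (flow q w t) w"
  define d where "d = (\<lambda>s. w - B (f (F (?\<phi> s))))"
  have \<phi>: "?\<phi> s = flow q w (t + s)" if "0 \<le> s" for s
    using flow_add[OF t that] .
  have "d \<in> disturbances"
  proof -
    obtain Lf where Lf: "Lf-lipschitz_on UNIV (\<lambda>x. f (F x))"
      using f ..
    have LB: "(norm B)-lipschitz_on UNIV (blinfun_apply B)"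
      by (intro lipschitz_onI) (simp_all add: dist_norm norm_blinfun flip: blinfun.diff_right)
    have "\<exists>L. L-lipschitz_on {0..b} d" for b
    proof -
      obtain L1 where L1: "L1-lipschitz_on {0..t + b} (\<lambda>s. T s q)"
        using q by blast
      obtain L2 where L2: "L2-lipschitz_on {0..t + b} (\<lambda>s. integral {0..s} (\<lambda>r. T r w))"
        using integral_T_lipschitz by blast
      have "(L1 + L2)-lipschitz_on {0..t + b} (flow q w)"
        unfolding flow_def using lipschitz_on_add[OF L1 L2] .
      then have L3: "(L1 + L2)-lipschitz_on ((\<lambda>s. t + s) ` {0..b}) (flow q w)"
        by (rule lipschitz_on_subset) (use t in auto)
      have "1-lipschitz_on {0..b} (\<lambda>s. t + s)"
        by (intro lipschitz_onI) auto
      from lipschitz_on_compose[OF this L3]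
      have "((L1 + L2) * 1)-lipschitz_on {0..b} ?\<phi>"
        by (rule lipschitz_on_transform) (simp add: \<phi>)
      from lipschitz_on_compose[OF this lipschitz_on_subset[OF Lf subset_UNIV]]
      have "(Lf * ((L1 + L2) * 1))-lipschitz_on {0..b} ((\<lambda>x. f (F x)) \<circ> ?\<phi>)" .
      from lipschitz_on_compose[OF this lipschitz_on_subset[OF LB subset_UNIV]]
      have "(norm B * (Lf * ((L1 + L2) * 1)))-lipschitz_on {0..b} (\<lambda>s. B (f (F (?\<phi> s))))"
        by (simp add: o_def)
      from lipschitz_on_diff[OF lipschitz_on_constant this, of w]
      show ?thesis unfolding d_def by blast
    qed
    then have "\<exists>L. L-lipschitz_on (cball s 1 \<inter> {0..}) d" for s
    proof -
      obtain L where "L-lipschitz_on {0..s + 1} d"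
        using \<open>\<And>b. \<exists>L. L-lipschitz_on {0..b} d\<close> by blast
      then have "L-lipschitz_on (cball s 1 \<inter> {0..}) d"
        by (rule lipschitz_on_subset) (auto simp: dist_real_def)
      then show ?thesis ..
    qed
    then show ?thesis
      unfolding disturbances_def using zero_less_one by blast
  qed
  moreover have "mild_solution T (\<lambda>s. B (f (F (?\<phi> s))) + d s) (flow q w t) ?\<phi>"
    using mild_solution_flow by (simp add: d_def)
  ultimately have "Limsup (at_right 0) (\<lambda>h. ereal ((V (?\<phi> h) - V (flow q w t)) / h))
      \<le> ereal (- \<alpha> (V (flow q w t)) + \<gamma> (norm (d 0)))"
    by (rule coercive_ISS_LyapunovD(9)[OF V])
  then have "upper_right_Dini (\<lambda>s. V (?\<phi> s)) 0 \<le> ereal (- \<alpha> (V (flow q w t)) + \<gamma> (norm (d 0)))"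
    by (simp add: upper_right_Dini_def)
  moreover have "upper_right_Dini (\<lambda>t. V (flow q w t)) t = upper_right_Dini (\<lambda>s. V (?\<phi> s)) 0"
    by (rule upper_right_Dini_cong[of 1]) (simp_all add: \<phi>)
  ultimately show ?thesis
    by (simp add: d_def)
qed

text \<open>Let \<open>c\<close> exceed the right-hand side. By continuity the right-hand side stays below \<open>c\<close> in a ball
  around \<open>p\<close>, and the flows from points \<open>q\<close> near \<open>p\<close> remain in that ball for a common time \<open>\<delta>\<close>. For those \<open>q\<close>
  with a Lipschitz orbit, \<open>V\<close> therefore grows by at most \<open>c h\<close> on \<open>[0, h]\<close>, \<open>h < \<delta>\<close>. This statement
  about increments survives the limit \<open>q \<rightarrow> p\<close>, which the one about derivatives would not.\<close>

lemma Dini_Lyapunov_flow_0: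
  assumes V: "coercive_ISS_Lyapunov T B f F V \<psi>1 \<psi>2 \<alpha> \<gamma>"
    and f: "\<exists>L. L-lipschitz_on UNIV (\<lambda>x. f (F x))"
  shows "upper_right_Dini (\<lambda>t. V (flow p w t)) 0 \<le> ereal (- \<alpha> (V p) + \<gamma> (norm (w - B (f (F p)))))"
proof -
  define W where "W = (\<lambda>x. - \<alpha> (V x) + \<gamma> (norm (w - B (f (F x)))))"
  have "continuous_on UNIV (\<lambda>x. f (F x))"
    using f lipschitz_on_continuous_on by blast
  moreover have "continuous_on {0..} \<alpha>" "continuous_on {0..} \<gamma>"
    using coercive_ISS_LyapunovD(5,6)[OF V] by (auto simp: class_K_infinity_iff)
  ultimately have f_cont: "continuous_on UNIV (\<lambda>x. norm (w - B (f (F x))))"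
    and \<alpha>: "continuous_on {0..} \<alpha>" and \<gamma>: "continuous_on {0..} \<gamma>"
    by (auto intro!: continuous_intros)
  have "continuous_on UNIV (\<lambda>x. \<alpha> (V x))"
    by (rule continuous_on_compose2[OF \<alpha> coercive_ISS_LyapunovD(1)[OF V]])
      (auto simp: coercive_ISS_LyapunovD(2)[OF V])
  moreover have "continuous_on UNIV (\<lambda>x. \<gamma> (norm (w - B (f (F x)))))"
    by (rule continuous_on_compose2[OF \<gamma> f_cont]) auto
  ultimately have W_cont: "continuous_on UNIV W"
    unfolding W_def by (intro continuous_intros)
  have "upper_right_Dini (\<lambda>t. V (flow p w t)) 0 \<le> ereal c" if c: "W p < c" for c
  proof -
    have "open (W -` {..<c})"
      using W_cont by (simp add: continuous_on_open_vimage)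
    then obtain \<epsilon> where \<epsilon>: "\<epsilon> > 0" "\<And>x. dist x p < \<epsilon> \<Longrightarrow> W x < c"
      using c unfolding open_dist by auto
    obtain \<delta>0 where \<delta>0: "\<delta>0 > 0" "\<And>s. 0 \<le> s \<Longrightarrow> s < \<delta>0 \<Longrightarrow> dist (flow p w s) p < \<epsilon> / 2"
    proof -
      have "\<exists>d>0. \<forall>s\<in>{0..}. dist s 0 < d \<longrightarrow> dist (flow p w s) (flow p w 0) < \<epsilon> / 2"
        using flow_continuous[of p w] \<epsilon>(1) unfolding continuous_on_iff
        by (meson atLeast_iff half_gt_zero order_refl)
      then show ?thesis
        using that by (auto simp: dist_real_def)
    qed
    define \<delta> where "\<delta> = \<delta>0 / 2"
    define C where "C = M * exp (\<nu> * \<delta>)"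
    have \<delta>: "0 < \<delta>" "\<delta> < \<delta>0" and C: "0 < C"
      using \<delta>0(1) M_ge_1 by (auto simp: \<delta>_def C_def)
    obtain q where q: "\<And>n. norm (q n - p) < 1 / real (Suc n)"
      "\<And>n b. \<exists>L. L-lipschitz_on {0..b} (\<lambda>t. T t (q n))"
    proof -
      have "\<forall>n. \<exists>q. norm (q - p) < 1 / real (Suc n) \<and> (\<forall>b. \<exists>L. L-lipschitz_on {0..b} (\<lambda>t. T t q))"
        by (intro allI lipschitz_orbits_dense) simp
      from choice[OF this] show ?thesis
        using that by blast
    qed
    have flow_q: "norm (flow (q n) w s - flow p w s) \<le> C * (1 / real (Suc n))"
      if "0 \<le> s" "s \<le> \<delta>" for n s
      unfolding C_def using norm_flow_diff_le[OF that, of "q n" w p] q(1)[of n] M_ge_1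
      by (intro order_trans[OF norm_flow_diff_le[OF that]] mult_left_mono) auto
    have lim: "(\<lambda>n. C * (1 / real (Suc n))) \<longlonglongrightarrow> 0"
      using tendsto_mult_right_zero[OF LIMSEQ_inverse_real_of_nat, of C] by (simp add: inverse_eq_divide)
    have flow_lim: "(\<lambda>n. flow (q n) w s) \<longlonglongrightarrow> flow p w s" if "0 \<le> s" "s \<le> \<delta>" for s
      by (rule LIM_zero_cancel, rule Lim_null_comparison[OF _ lim]) (use flow_q[OF that] in simp)
    have V_lim: "(\<lambda>n. V (flow (q n) w s)) \<longlonglongrightarrow> V (flow p w s)" if "0 \<le> s" "s \<le> \<delta>" for s
      using coercive_ISS_LyapunovD(1)[OF V] flow_lim[OF that]
      by (intro continuous_on_tendsto_compose[of UNIV V]) auto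
    have "eventually (\<lambda>n. C * (1 / real (Suc n)) < \<epsilon> / 2) sequentially"
      using lim \<epsilon>(1) by (intro order_tendstoD) auto
    then have ev: "eventually (\<lambda>n. V (flow (q n) w h) - V (flow (q n) w 0) \<le> c * (h - 0)) sequentially"
      if h: "0 < h" "h < \<delta>" for h
    proof eventually_elim
      case (elim n)
      show ?case
      proof (rule upper_right_Dini_less_imp_increment_le)
        have "continuous_on {0..h} (flow (q n) w)"
          by (rule continuous_on_subset[OF flow_continuous]) auto
        then show "continuous_on {0..h} (\<lambda>s. V (flow (q n) w s))"
          by (rule continuous_on_compose2[OF coercive_ISS_LyapunovD(1)[OF V]]) auto
        fix s assume s: "0 \<le> s" "s < h"
        have "dist (flow (q n) w s) p < \<epsilon>"
        proof (rule dist_triangle_half_l)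
          show "dist (flow (q n) w s) (flow p w s) < \<epsilon> / 2"
            unfolding dist_norm by (rule le_less_trans[OF flow_q elim]) (use s h in auto)
          show "dist p (flow p w s) < \<epsilon> / 2"
            using \<delta>0(2)[of s] s h \<delta> by (simp add: dist_commute)
        qed
        then have "W (flow (q n) w s) < c"
          by (rule \<epsilon>(2))
        then show "upper_right_Dini (\<lambda>s. V (flow (q n) w s)) s < ereal c"
          using Dini_Lyapunov_flow_lipschitz_orbit[OF V f q(2) s(1), of n w]
          by (simp add: W_def le_less_trans)
      qed (use h in auto)
    qed
    have "V (flow p w (0 + h)) - V (flow p w 0) \<le> c * h" if h: "0 < h" "h < \<delta>" for h
      using tendsto_upperbound[OF tendsto_diff[OF V_lim V_lim] ev[OF h]] h \<delta> by simp
    then show ?thesis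
      using \<delta>(1) by (intro upper_right_Dini_leI)
  qed
  then have "upper_right_Dini (\<lambda>t. V (flow p w t)) 0 \<le> ereal (W p)"
    by (metis ereal_dense2 ereal_less_eq(3) less_ereal.simps(1) linorder_not_less)
  then show ?thesis
    by (simp add: W_def)
qed

lemma Dini_Lyapunov_flow:
  assumes "coercive_ISS_Lyapunov T B f F V \<psi>1 \<psi>2 \<alpha> \<gamma>"
    and "\<exists>L. L-lipschitz_on UNIV (\<lambda>x. f (F x))" and t: "0 \<le> t"
  shows "upper_right_Dini (\<lambda>t. V (flow p w t)) t
    \<le> ereal (- \<alpha> (V (flow p w t)) + \<gamma> (norm (w - B (f (F (flow p w t))))))"
proof -
  have "upper_right_Dini (\<lambda>t. V (flow p w t)) t = upper_right_Dini (\<lambda>s. V (flow (flow p w t) w s)) 0"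
    by (rule upper_right_Dini_cong[of 1]) (simp_all add: flow_add t)
  then show ?thesis
    using Dini_Lyapunov_flow_0[OF assms(1,2)] by simp
qed

section \<open>Solutions with piecewise constant input\<close>

text \<open>The one step from which both uniqueness (\<open>mild_solution_const_input\<close>) and existence
  (\<open>ex_switched_solution\<close>) are obtained: apply \<open>T (t - a)\<close> to the variation-of-constants formula up to
  time \<open>a\<close> and append the constant-input piece. Here \<open>y\<close> is the state at time \<open>a\<close>.\<close>

lemma has_integral_extend_const_input:
  assumes "0 \<le> a" "a \<le> t"
    and y: "((\<lambda>s. T (a - s) (v s)) has_integral (y - T a x0)) {0..a}"
    and v: "\<And>s. a \<le> s \<Longrightarrow> s < t \<Longrightarrow> v s = w"
  shows "((\<lambda>s. T (t - s) (v s)) has_integral (flow y w (t - a) - T t x0)) {0..t}"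
proof -
  have "((T (t - a) \<circ> (\<lambda>s. T (a - s) (v s))) has_integral T (t - a) (y - T a x0)) {0..a}"
    by (rule has_integral_linear[OF y blinfun.bounded_linear_right])
  also have "T (t - a) (y - T a x0) = T (t - a) y - T t x0"
    using T_add[of "t - a" a x0] assms by (simp add: blinfun.diff_right)
  finally have "((T (t - a) \<circ> (\<lambda>s. T (a - s) (v s))) has_integral (T (t - a) y - T t x0)) {0..a}" .
  then have 1: "((\<lambda>s. T (t - s) (v s)) has_integral (T (t - a) y - T t x0)) {0..a}"
  proof (rule has_integral_eq[rotated])
    fix s assume "s \<in> {0..a}"
    then show "(T (t - a) \<circ> (\<lambda>s. T (a - s) (v s))) s = T (t - s) (v s)"
      using T_add[of "t - a" "a - s" "v s"] \<open>a \<le> t\<close> by simp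
  qed
  have 2: "((\<lambda>s. T (t - s) (v s)) has_integral (flow y w (t - a) - T (t - a) y)) {a..t}"
    by (rule has_integral_spike_finite[OF _ _ flow_has_integral[OF \<open>a \<le> t\<close>], of "{t}"]) (simp_all add: v)
  show ?thesis
    using has_integral_combine[OF assms(1,2) 1 2] by simp
qed

lemma mild_solution_const_input:
  assumes x: "mild_solution T v x0 x" and "0 \<le> a" "a \<le> t"
    and "\<And>s. a \<le> s \<Longrightarrow> s < t \<Longrightarrow> v s = w"
  shows "x t = flow (x a) w (t - a)"
proof -
  have "((\<lambda>s. T (a - s) (v s)) has_integral (x a - T a x0)) {0..a}"
    and t: "((\<lambda>s. T (t - s) (v s)) has_integral (x t - T t x0)) {0..t}"
    using x assms by (auto simp: mild_solution_def)
  from has_integral_unique[OF t has_integral_extend_const_input[OF assms(2,3) this(1) assms(4)]]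
  show ?thesis
    by simp
qed

lemma mild_solution_at_0:
  assumes "mild_solution T v x0 x"
  shows "x 0 = x0"
proof -
  have "((\<lambda>s. T (0 - s) (v s)) has_integral (x 0 - T 0 x0)) (cbox 0 0)"
    using assms unfolding mild_solution_def by auto
  from has_integral_unique[OF this has_integral_refl(1)] show ?thesis
    by simp
qed

text \<open>\<open>D p\<close> is the time until the next switch and \<open>w p\<close> the constant input, both determined by the state
  \<open>p\<close> at the last switch; \<open>D p = \<infinity>\<close> is allowed. The function \<open>k\<close> gives the index of the round in progress.\<close>

lemma ex_switched_solution:
  fixes D :: "'h \<Rightarrow> ereal" and w :: "'h \<Rightarrow> 'h"
  assumes \<tau>: "0 < \<tau>" and D: "\<And>p. ereal \<tau> \<le> D p"
  shows "\<exists>t x k. t 0 = 0 \<and> (\<forall>j. t (Suc j) = t j + D (x (real_of_ereal (t j)))) \<and>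
    (\<forall>s j. t j \<le> ereal s \<and> ereal s < t (Suc j) \<longrightarrow> k s = j) \<and>
    mild_solution T (\<lambda>s. w (x (real_of_ereal (t (k s))))) x0 x"
proof -
  \<comment> \<open>pairs of the \<open>j\<close>-th switching time and the state there; the state is a dummy once the time is \<open>\<infinity>\<close>\<close>
  define P where "P = rec_nat (0 :: ereal, x0)
    (\<lambda>_ (a, p). (a + D p, flow p (w p) (real_of_ereal (D p))))"
  define t where "t = (\<lambda>j. fst (P j))"
  define p where "p = (\<lambda>j. snd (P j))"
  have t0: "t 0 = 0" and p0: "p 0 = x0"
    by (simp_all add: t_def p_def P_def)
  have tS: "t (Suc j) = t j + D (p j)" and pS: "p (Suc j) = flow (p j) (w (p j)) (real_of_ereal (D (p j)))" for j
    by (simp_all add: t_def p_def P_def split: prod.split)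
  have t\<tau>: "t j + ereal \<tau> \<le> t (Suc j)" for j
    unfolding tS by (intro add_mono order_refl D)
  then have t: "switching_times \<tau> t"
    using \<tau> t0 by (simp add: switching_times_def)
  define k where "k = (\<lambda>s. SOME j. t j \<le> ereal s \<and> ereal s < t (Suc j))"
  have k_ex: "t (k s) \<le> ereal s \<and> ereal s < t (Suc (k s))" if "0 \<le> s" for s
    unfolding k_def by (rule someI_ex[OF switching_index_exists[OF t that]])
  have k_eq: "k s = j" if "t j \<le> ereal s" "ereal s < t (Suc j)" for s j
    unfolding k_def using that by (intro some_equality) (auto intro: switching_index_unique[OF t])
  define x where "x = (\<lambda>s. flow (p (k s)) (w (p (k s))) (s - real_of_ereal (t (k s))))"
  have x_eq: "x s = flow (p j) (w (p j)) (s - a)"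
    if j: "t j = ereal a" "a \<le> s" "ereal s \<le> t (Suc j)" for s j a
  proof (cases "ereal s < t (Suc j)")
    case True
    then show ?thesis using k_eq[of j s] j by (simp add: x_def)
  next
    case False
    with j have s: "t (Suc j) = ereal s" by simp
    then have "ereal s < t (Suc (Suc j))"
      using t\<tau>[of "Suc j"] \<tau> by (intro less_le_trans[OF _ t\<tau>]) simp
    then have "k s = Suc j"
      using s by (intro k_eq) auto
    moreover have "D (p j) = ereal (s - a)"
      using tS[of j] s j by (cases "D (p j)") auto
    ultimately show ?thesis
      using s by (simp add: x_def pS)
  qed
  have x_t: "x a = p j" if "t j = ereal a" for j a
    using x_eq[of j a a] that switching_times_mono[OF t, of j "Suc j"] by simp
  let ?v = "\<lambda>s. w (x (real_of_ereal (t (k s))))"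
  have v: "?v s = w (p j)" if "t j = ereal a" "a \<le> s" "ereal s < t (Suc j)" for s j a
    using k_eq[of j s] that x_t by simp
  have "t (Suc j) = t j + D (x (real_of_ereal (t j)))" for j
  proof (cases "t j")
    case (real a)
    then show ?thesis using x_t[OF real] by (simp add: tS)
  next
    case PInf
    then show ?thesis by (simp add: tS)
  next
    case MInf
    then show ?thesis
      using switching_times_ge[OF t, of j] by simp
  qed
  moreover have "mild_solution T ?v x0 x"
    unfolding mild_solution_def
  proof (intro conjI allI impI)
    have int: "\<forall>s\<ge>0. ereal s \<le> t j \<longrightarrow> ((\<lambda>r. T (s - r) (?v r)) has_integral (x s - T s x0)) {0..s}" for j
    proof (induction j)
      case 0
      have "x 0 = x0"
        using x_t[of 0 0] t0 p0 by (simp add: zero_ereal_def)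
      then show ?case
        by (auto simp: t0 dest: antisym)
    next
      case (Suc j)
      show ?case
      proof (intro allI impI)
        fix s assume s: "0 \<le> s" "ereal s \<le> t (Suc j)"
        show "((\<lambda>r. T (s - r) (?v r)) has_integral (x s - T s x0)) {0..s}"
        proof (cases "ereal s \<le> t j")
          case False
          then obtain a where a: "t j = ereal a" "0 \<le> a" "a \<le> s"
            using switching_times_mono[OF t, of 0 j] t0 by (cases "t j") auto
          then have "((\<lambda>r. T (a - r) (?v r)) has_integral (p j - T a x0)) {0..a}"
            using Suc x_t by auto
          then have "((\<lambda>r. T (s - r) (?v r)) has_integral (flow (p j) (w (p j)) (s - a) - T s x0)) {0..s}"
          proof (rule has_integral_extend_const_input[OF a(2,3)])
            fix r assume "a \<le> r" "r < s"
            then show "?v r = w (p j)"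
              by (intro v[OF a(1)] less_le_trans[OF _ s(2)]) simp_all
          qed
          then show ?thesis
            using x_eq[OF a(1,3) s(2)] by simp
        qed (use Suc s in blast)
      qed
    qed
    show "((\<lambda>r. T (s - r) (?v r)) has_integral (x s - T s x0)) {0..s}" if "0 \<le> s" for s
      using int[of "Suc (k s)"] k_ex[OF that] that by (simp add: less_imp_le)
    have cont: "\<forall>b. ereal b \<le> t j \<longrightarrow> continuous_on {0..b} x" for j
    proof (induction j)
      case 0
      show ?case
      proof (intro allI impI)
        fix b assume "ereal b \<le> t 0"
        then show "continuous_on {0..b} x"
          by (intro continuous_on_subset[OF continuous_on_sing[of 0 x]]) (auto simp: t0)
      qed
    next
      case (Suc j)
      show ?case
      proof (intro allI impI)
        fix b assume b: "ereal b \<le> t (Suc j)"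
        show "continuous_on {0..b} x"
        proof (cases "ereal b \<le> t j")
          case False
          then obtain a where a: "t j = ereal a" "0 \<le> a" "a \<le> b"
            using switching_times_mono[OF t, of 0 j] t0 by (cases "t j") auto
          have "continuous_on {a..b} (\<lambda>s. flow (p j) (w (p j)) (s - a))"
            by (intro continuous_on_compose2[OF flow_continuous] continuous_intros) auto
          then have "continuous_on {a..b} x"
            by (rule continuous_on_eq) (auto intro!: x_eq[OF a(1), symmetric] order_trans[OF _ b])
          moreover have "continuous_on {0..a} x"
            using Suc a by simp
          ultimately have "continuous_on ({0..a} \<union> {a..b}) x"
            by (intro continuous_on_closed_Un) auto
          moreover have "{0..a} \<union> {a..b} = {0..b}"
            using a by auto
          ultimately show ?thesis by simp
        qed (use Suc in blast)
      qed
    qed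
    have "continuous_on {0..b} x" for b
      using cont[of "Suc (k b)"] k_ex[of b] by (cases "0 \<le> b") (auto simp: less_imp_le)
    then show "continuous_on {0..} x"
      by (rule continuous_on_atLeastI)
  qed
  ultimately show ?thesis
    using t0 k_eq by (intro exI[of _ t] exI[of _ x] exI[of _ k]) blast
qed

lemma ex_sampled_data_solution:
  assumes \<tau>: "0 < \<tau>"
  shows "\<exists>x. sampled_data_solution T B f F \<tau> x0 x"
proof -
  obtain t x k where t: "t 0 = 0" "\<And>j. t (Suc j) = t j + ereal \<tau>"
    and k: "\<And>s j. t j \<le> ereal s \<Longrightarrow> ereal s < t (Suc j) \<Longrightarrow> k s = j"
    and x: "mild_solution T (\<lambda>s. B (f (F (x (real_of_ereal (t (k s))))))) x0 x"
    using ex_switched_solution[where D = "\<lambda>_. ereal \<tau>" and w = "\<lambda>p. B (f (F p))" and ?x0.0 = x0,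
        OF \<tau> order_refl] by blast
  have t_eq: "t j = ereal (real j * \<tau>)" for j
    by (induction j) (simp_all add: t zero_ereal_def algebra_simps)
  have "k s = j" if "s \<in> {real j * \<tau>..<real (Suc j) * \<tau>}" for s j
    using that by (intro k) (simp_all add: t_eq del: of_nat_Suc)
  then show ?thesis
    unfolding sampled_data_solution_def using x
    by (intro exI[of _ x] exI[of _ "\<lambda>s. F (x (real_of_ereal (t (k s))))"]) (auto simp: t_eq)
qed

text \<open>The estimate is known for sampled-data solutions on the half-line, so that one has to be
  constructed first; on its first sampling interval it is a flow with constant input.\<close>

lemma flow_sampled_data_bound:
  assumes \<tau>: "0 < \<tau>" and bound: "\<forall>x0 x. sampled_data_solution T B f F \<tau> x0 x \<longrightarrow>
      (\<forall>t\<ge>0. norm (x t) \<le> G * exp (- \<eta> * t) * norm x0)"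
    and s: "0 \<le> s" "s \<le> \<tau>"
  shows "norm (flow p (B (f (F p))) s) \<le> G * exp (- \<eta> * s) * norm p"
proof -
  obtain x where x: "sampled_data_solution T B f F \<tau> p x"
    using ex_sampled_data_solution[OF \<tau>] by blast
  then obtain u where u: "\<And>t. t \<in> {real 0 * \<tau>..<real (Suc 0) * \<tau>} \<Longrightarrow> u t = F (x (real 0 * \<tau>))"
    and mild: "mild_solution T (\<lambda>t. B (f (u t))) p x"
    unfolding sampled_data_solution_def by blast
  have x0: "x 0 = p"
    by (rule mild_solution_at_0[OF mild])
  have "x s = flow (x 0) (B (f (F p))) (s - 0)"
    using s by (intro mild_solution_const_input[OF mild]) (simp_all add: u x0)
  then show ?thesis
    using bound[rule_format, OF x s(1)] by (simp add: x0)
qed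

lemma mild_solution_on_switching_interval:
  assumes x: "mild_solution T v x0 x"
    and v: "\<And>s. a \<le> s \<Longrightarrow> ereal s < b \<Longrightarrow> v s = w"
    and a: "0 \<le> a" and s: "0 \<le> s" "ereal (a + s) \<le> b"
  shows "x (a + s) = flow (x a) w s"
proof -
  have "v r = w" if "a \<le> r" "r < a + s" for r
    using that by (intro v less_le_trans[OF _ s(2)]) simp_all
  then have "x (a + s) = flow (x a) w (a + s - a)"
    using a s by (intro mild_solution_const_input[OF x]) auto
  then show ?thesis by simp
qed

text \<open>Take as duration \<open>D p\<close> the first time at which the triggering condition holds along the flow from
  \<open>p\<close>. The triggering rule tests the condition along the solution itself, which follows this flow up to
  and including the next event but not beyond. The two infima agree because the condition is closed:
  it already holds at the infimum.\<close>

lemma ex_event_triggered_solution: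
  assumes V: "coercive_ISS_Lyapunov T B f F V \<psi>1 \<psi>2 \<alpha> \<gamma>"
    and f: "\<exists>L. L-lipschitz_on UNIV (\<lambda>x. f (F x))" and \<tau>: "0 < \<tau>"
  shows "\<exists>x. event_triggered_solution T B f F V \<alpha> \<gamma> \<sigma> \<tau> x0 x"
proof -
  define S where "S = (\<lambda>p. {s. \<tau> \<le> s \<and> \<sigma> * \<alpha> (V (flow p (B (f (F p))) s))
    \<le> \<gamma> (norm (B (f (F p) - f (F (flow p (B (f (F p))) s)))))})"
  define D where "D = (\<lambda>p. Inf (ereal ` S p))"
  have D: "ereal \<tau> \<le> D p" for p
    unfolding D_def by (rule Inf_greatest) (auto simp: S_def)
  have closed_S: "closed (S p)" for p
  proof -
    let ?z = "flow p (B (f (F p)))"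
    have z: "continuous_on {\<tau>..} ?z"
      by (rule continuous_on_subset[OF flow_continuous]) (use \<tau> in auto)
    have "continuous_on UNIV (\<lambda>x. f (F x))"
      using f lipschitz_on_continuous_on by blast
    then have fz: "continuous_on {\<tau>..} (\<lambda>s. f (F (?z s)))"
      by (rule continuous_on_compose2[OF _ z]) auto
    have \<alpha>: "continuous_on {0..} \<alpha>" and \<gamma>: "continuous_on {0..} \<gamma>"
      using coercive_ISS_LyapunovD(5,6)[OF V] by (auto simp: class_K_infinity_iff)
    have "continuous_on {\<tau>..} (\<lambda>s. V (?z s))"
      by (rule continuous_on_compose2[OF coercive_ISS_LyapunovD(1)[OF V] z]) auto
    then have 1: "continuous_on {\<tau>..} (\<lambda>s. \<alpha> (V (?z s)))"
      by (rule continuous_on_compose2[OF \<alpha>]) (auto simp: coercive_ISS_LyapunovD(2)[OF V])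
    have "continuous_on {\<tau>..} (\<lambda>s. norm (B (f (F p) - f (F (?z s)))))"
      by (intro continuous_intros fz)
    then have 2: "continuous_on {\<tau>..} (\<lambda>s. \<gamma> (norm (B (f (F p) - f (F (?z s))))))"
      by (rule continuous_on_compose2[OF \<gamma>]) auto
    have "closed ({\<tau>..} \<inter> (\<lambda>s. \<sigma> * \<alpha> (V (?z s)) - \<gamma> (norm (B (f (F p) - f (F (?z s)))))) -` {..0})"
      by (intro continuous_closed_preimage continuous_intros 1 2)
    also have "\<dots> = S p"
      by (auto simp: S_def)
    finally show ?thesis .
  qed
  obtain t x k where t0: "t 0 = 0" and tS: "\<And>j. t (Suc j) = t j + D (x (real_of_ereal (t j)))"
    and k: "\<And>s j. t j \<le> ereal s \<Longrightarrow> ereal s < t (Suc j) \<Longrightarrow> k s = j"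
    and x: "mild_solution T (\<lambda>s. B (f (F (x (real_of_ereal (t (k s))))))) x0 x"
    using ex_switched_solution[where D = D and w = "\<lambda>p. B (f (F p))" and ?x0.0 = x0, OF \<tau> D] by blast
  have t\<tau>: "t j + ereal \<tau> \<le> t (Suc j)" for j
    unfolding tS by (intro add_mono order_refl D)
  then have t: "switching_times \<tau> t"
    using \<tau> t0 by (simp add: switching_times_def)
  have events: "t (Suc j) = Inf (ereal ` {s. ereal s \<ge> t j + ereal \<tau> \<and>
      \<gamma> (norm (B (f (F (x (real_of_ereal (t j)))) - f (F (x s))))) \<ge> \<sigma> * \<alpha> (V (x s))})"
    (is "_ = Inf (ereal ` ?X)") for j
  proof (cases "t j")
    case (real a)
    have a: "0 \<le> a"
      using switching_times_mono[OF t, of 0 j] t0 real by simp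
    let ?z = "flow (x a) (B (f (F (x a))))"
    have xz: "x (a + s) = ?z s" if "0 \<le> s" "ereal (a + s) \<le> t (Suc j)" for s
      by (rule mild_solution_on_switching_interval[OF x _ a that]) (simp add: k[of j] real)
    have X_iff: "s \<in> ?X \<longleftrightarrow> s - a \<in> S (x a)" if "a \<le> s" "ereal s \<le> t (Suc j)" for s
      using xz[of "s - a"] that real by (auto simp: S_def)
    have X_ge: "a + \<tau> \<le> s" if "s \<in> ?X" for s
      using that real by simp
    show ?thesis
    proof (cases "S (x a) = {}")
      case True
      then have inf: "t (Suc j) = \<infinity>"
        by (simp add: tS real D_def top_ereal_def)
      then have "?X = {}"
      proof -
        have False if s: "s \<in> ?X" for s
          using iffD1[OF X_iff s] X_ge[OF s] \<tau> True inf by simp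
        then show ?thesis by blast
      qed
      then show ?thesis
        by (simp only: inf image_empty Inf_empty top_ereal_def)
    next
      case False
      define d where "d = Inf (S (x a))"
      have bdd: "bdd_below (S (x a))"
        by (auto simp: S_def intro!: bdd_belowI[of _ \<tau>])
      have d: "d \<in> S (x a)" "\<And>s. s \<in> S (x a) \<Longrightarrow> d \<le> s"
        unfolding d_def using closed_contains_Inf[OF False bdd closed_S] cInf_lower[OF _ bdd] by auto
      have "0 \<le> d"
        using d(1) \<tau> by (simp add: S_def)
      have td: "t (Suc j) = ereal (a + d)"
        using ereal_Inf'[OF bdd False] by (simp add: tS real D_def d_def flip: plus_ereal.simps(1))
      have "a + d \<in> ?X"
        using X_iff[of "a + d"] \<open>0 \<le> d\<close> td d(1) by simp
      moreover have "a + d \<le> s" if "s \<in> ?X" for s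
      proof (rule ccontr)
        assume "\<not> a + d \<le> s"
        then have "s - a \<in> S (x a)"
          using X_ge[OF that] \<tau> td by (intro iffD1[OF X_iff that]) simp_all
        from d(2)[OF this] \<open>\<not> a + d \<le> s\<close> show False by simp
      qed
      ultimately have "Inf (ereal ` ?X) = ereal (a + d)"
        by (intro antisym Inf_lower Inf_greatest) auto
      then show ?thesis
        by (simp only: td)
    qed
  next
    case PInf
    then show ?thesis
      by (simp add: tS top_ereal_def)
  next
    case MInf
    then show ?thesis
      using switching_times_mono[OF t, of 0 j] t0 by simp
  qed
  show ?thesis
    unfolding event_triggered_solution_def
    by (intro exI[of _ x] exI[of _ t] exI[of _ "\<lambda>s. F (x (real_of_ereal (t (k s))))"] conjI allI impI t0 x events)
      (metis k)
qed

section \<open>From one event to the next\<close>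

text \<open>As long as no event has occurred, the disturbance \<open>B(f(F p) - f(F z))\<close> costs at most the fraction \<open>\<sigma>\<close>
  of the decay rate \<open>\<alpha>\<close>, so \<open>V\<close> along the flow obeys the comparison inequality from time \<open>\<tau>\<close> on; the bounds
  \<open>\<psi>1\<close> and \<open>\<psi>2\<close> translate this back to norms.\<close>

lemma norm_flow_before_event_le_rho:
  fixes p :: 'h
  assumes V: "coercive_ISS_Lyapunov T B f F V \<psi>1 \<psi>2 \<alpha> \<gamma>"
    and f: "\<exists>L. L-lipschitz_on UNIV (\<lambda>x. f (F x))"
    and \<kappa>: "class_KL \<kappa>" "comparison_property \<kappa> \<alpha> \<sigma>" and \<sigma>: "\<sigma> < 1"
    and \<tau>: "0 \<le> \<tau>" and b: "0 \<le> b"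
  defines "z \<equiv> flow p (B (f (F p)))"
  assumes z\<tau>: "norm (z \<tau>) \<le> G * exp (- \<eta> * \<tau>) * norm p"
    and no_event: "\<And>s. \<tau> \<le> s \<Longrightarrow> s < \<tau> + b \<Longrightarrow>
      \<gamma> (norm (B (f (F p) - f (F (z s))))) < \<sigma> * \<alpha> (V (z s))"
  shows "norm (z (\<tau> + b)) \<le> rho \<psi>1 \<psi>2 \<kappa> G \<eta> \<tau> (norm p) b"
proof -
  note VD = coercive_ISS_LyapunovD[OF V]
  define y where "y = (\<lambda>s. V (z (\<tau> + s)))"
  have "y b \<le> \<kappa> (y 0) b"
  proof (rule comparison_property_on_interval[OF \<kappa>(2) VD(5) \<sigma>])
    have "continuous_on {0..b} (\<lambda>s. z (\<tau> + s))"
      unfolding z_def using \<tau> by (intro continuous_on_compose2[OF flow_continuous] continuous_intros) auto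
    then show "continuous_on {0..b} y"
      unfolding y_def by (rule continuous_on_compose2[OF VD(1)]) auto
    fix s assume s: "0 \<le> s" "s < b"
    have "upper_right_Dini y s = upper_right_Dini (\<lambda>t. V (z t)) (\<tau> + s)"
      by (rule upper_right_Dini_cong[of 1]) (simp_all add: y_def add.assoc)
    also have "\<dots> \<le> ereal (- \<alpha> (y s) + \<gamma> (norm (B (f (F p) - f (F (z (\<tau> + s)))))))"
      using Dini_Lyapunov_flow[OF V f, of "\<tau> + s" p "B (f (F p))"] \<tau> s
      by (simp add: z_def y_def blinfun.diff_right)
    also have "\<dots> \<le> ereal (- (1 - \<sigma>) * \<alpha> (y s))"
      using no_event[of "\<tau> + s"] s by (simp add: y_def algebra_simps)
    finally show "upper_right_Dini y s \<le> ereal (- (1 - \<sigma>) * \<alpha> (y s))" .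
  qed (use b VD(2) in \<open>auto simp: y_def\<close>)
  also have "\<dots> \<le> \<kappa> (\<psi>2 (G * exp (- \<eta> * \<tau>) * norm p)) b"
  proof (rule class_KL_mono[OF \<kappa>(1)])
    have "y 0 \<le> \<psi>2 (norm (z \<tau>))"
      using VD(8) by (simp add: y_def)
    also have "\<dots> \<le> \<psi>2 (G * exp (- \<eta> * \<tau>) * norm p)"
      by (rule class_K_mono[OF _ _ z\<tau>]) (use VD(4) in \<open>simp_all add: class_K_inf_def\<close>)
    finally show "y 0 \<le> \<psi>2 (G * exp (- \<eta> * \<tau>) * norm p)" .
  qed (use b VD(2) in \<open>auto simp: y_def\<close>)
  finally have "\<psi>1 (norm (z (\<tau> + b))) \<le> \<kappa> (\<psi>2 (G * exp (- \<eta> * \<tau>) * norm p)) b"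
    using VD(7)[of "z (\<tau> + b)"] by (simp add: y_def)
  then show ?thesis
    unfolding rho_def by (intro class_K_inf_le_inverse[OF VD(3)]) simp_all
qed

lemma norm_event_triggered_solution_le:
  assumes V: "coercive_ISS_Lyapunov T B f F V \<psi>1 \<psi>2 \<alpha> \<gamma>"
    and f: "\<exists>L. L-lipschitz_on UNIV (\<lambda>x. f (F x))"
    and \<kappa>: "class_KL \<kappa>" "comparison_property \<kappa> \<alpha> \<sigma>" and \<sigma>: "\<sigma> < 1"
    and \<tau>: "0 < \<tau>" and G: "1 \<le> G" and \<eta>: "0 < \<eta>"
    and sampled: "\<forall>x0 x. sampled_data_solution T B f F \<tau> x0 x \<longrightarrow>
      (\<forall>t\<ge>0. norm (x t) \<le> G * exp (- \<eta> * t) * norm x0)"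
    and \<mu>: "class_KL \<mu>" and \<omega>: "class_L \<omega>"
    and iterates: "\<And>K m n. 1 \<le> K \<Longrightarrow> 0 \<le> m \<Longrightarrow> (\<And>j. j \<in> {1..K} \<Longrightarrow> 0 \<le> n j) \<Longrightarrow>
      iterate_R (rho \<psi>1 \<psi>2 \<kappa> G \<eta> \<tau>) K m n \<le> \<mu> (\<omega> (real K) * m) (Max (n ` {1..K}))"
    and x: "event_triggered_solution T B f F V \<alpha> \<gamma> \<sigma> \<tau> x0 x" and s: "0 \<le> s"
  defines "S \<equiv> sqrt (max 0 (s - \<tau>))"
  shows "norm (x s) \<le> G * exp (- \<eta> * s) * norm x0 +
    G * (\<mu> (\<omega> S * norm x0) 0 + \<mu> (\<omega> 0 * norm x0) (max 0 (S - \<tau>)))"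
proof -
  obtain t u where t0: "t 0 = 0"
    and events: "\<And>k. t (Suc k) = Inf (ereal ` {s. ereal s \<ge> t k + ereal \<tau> \<and>
      \<gamma> (norm (B (f (F (x (real_of_ereal (t k)))) - f (F (x s))))) \<ge> \<sigma> * \<alpha> (V (x s))})"
    and u: "\<And>k s. t k \<le> ereal s \<Longrightarrow> ereal s < t (Suc k) \<Longrightarrow> u s = F (x (real_of_ereal (t k)))"
    and mild: "mild_solution T (\<lambda>s. B (f (u s))) x0 x"
    using x unfolding event_triggered_solution_def by blast
  have t\<tau>: "t j + ereal \<tau> \<le> t (Suc j)" for j
    unfolding events[of j] by (rule Inf_greatest) auto
  have t: "switching_times \<tau> t"
    using \<tau> t0 t\<tau> by (simp add: switching_times_def)
  have x_flow: "x (a + s) = flow (x a) (B (f (F (x a)))) s"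
    if "t j = ereal a" "0 \<le> s" "ereal (a + s) \<le> t (Suc j)" for j a s
  proof (rule mild_solution_on_switching_interval[OF mild])
    show "0 \<le> a"
      using switching_times_mono[OF t, of 0 j] t0 that by simp
    show "B (f (u r)) = B (f (F (x a)))" if "a \<le> r" "ereal r < t (Suc j)" for r
      using u[of j r] that \<open>t j = ereal a\<close> by simp
  qed (use that in auto)
  have flow_bound: "norm (flow p (B (f (F p))) s) \<le> G * exp (- \<eta> * s) * norm p" if "0 \<le> s" "s \<le> \<tau>" for p s
    by (rule flow_sampled_data_bound[OF \<tau> sampled that])
  have dwell: "norm (x (a + s)) \<le> G * exp (- \<eta> * s) * norm (x a)"
    if "t j = ereal a" "0 \<le> s" "s \<le> \<tau>" for j a s
  proof -
    have "ereal (a + s) \<le> t (Suc j)"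
      using that by (intro order_trans[OF _ t\<tau>]) simp
    then show ?thesis
      using x_flow[of j a s] flow_bound[of s "x a"] that by simp
  qed
  have decay: "norm (x (a + \<tau> + b)) \<le> rho \<psi>1 \<psi>2 \<kappa> G \<eta> \<tau> (norm (x a)) b"
    if a: "t j = ereal a" and b: "0 \<le> b" "ereal (a + \<tau> + b) \<le> t (Suc j)" for j a b
  proof -
    have "norm (flow (x a) (B (f (F (x a)))) (\<tau> + b)) \<le> rho \<psi>1 \<psi>2 \<kappa> G \<eta> \<tau> (norm (x a)) b"
    proof (rule norm_flow_before_event_le_rho[OF V f \<kappa> \<sigma> less_imp_le[OF \<tau>] b(1)])
      show "norm (flow (x a) (B (f (F (x a)))) \<tau>) \<le> G * exp (- \<eta> * \<tau>) * norm (x a)"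
        using \<tau> by (intro flow_bound) auto
      fix s assume s: "\<tau> \<le> s" "s < \<tau> + b"
      have lt: "ereal (a + s) < t (Suc j)"
        using s by (intro less_le_trans[OF _ b(2)]) simp
      have "\<not> \<sigma> * \<alpha> (V (x (a + s))) \<le> \<gamma> (norm (B (f (F (x a)) - f (F (x (a + s))))))"
      proof
        assume "\<sigma> * \<alpha> (V (x (a + s))) \<le> \<gamma> (norm (B (f (F (x a)) - f (F (x (a + s))))))"
        then have "t (Suc j) \<le> ereal (a + s)"
          unfolding events[of j] using a s by (intro Inf_lower) simp
        with lt show False by simp
      qed
      then show "\<gamma> (norm (B (f (F (x a)) - f (F (flow (x a) (B (f (F (x a)))) s)))))
          < \<sigma> * \<alpha> (V (flow (x a) (B (f (F (x a)))) s))"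
        using x_flow[OF a, of s] s \<tau> lt by simp
    qed
    then show ?thesis
      using x_flow[OF a, of "\<tau> + b"] b \<tau> by (simp add: add.assoc)
  qed
  have x0: "x 0 = x0"
    by (rule mild_solution_at_0[OF mild])
  have "0 \<le> G"
    using G by simp
  note \<psi> = coercive_ISS_LyapunovD(3,4)[OF V]
  show ?thesis
    unfolding S_def x0[symmetric]
    by (rule norm_le_KL_bound_of_iterates[OF t G \<eta> rho_nonneg[OF \<psi> \<kappa>(1) \<open>0 \<le> G\<close>]
          rho_mono[OF \<psi> \<kappa>(1) \<open>0 \<le> G\<close>] dwell decay \<mu> \<omega> iterates s])
qed

end

theorem theorem1:
  fixes A :: "'h::{real_inner,banach} \<Rightarrow> 'h" and dom_A :: "'h set"
    and T T\<^sub>B\<^sub>F :: "real \<Rightarrow> 'h \<Rightarrow>\<^sub>L 'h"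
    and B :: "'u::{real_inner,banach} \<Rightarrow>\<^sub>L 'h" and F :: "'h \<Rightarrow>\<^sub>L 'u"
    and f :: "'u \<Rightarrow> 'u" and V :: "'h \<Rightarrow> real"
    and \<psi>1 \<psi>2 \<alpha> \<gamma> :: "real \<Rightarrow> real" and \<kappa> :: "real \<Rightarrow> real \<Rightarrow> real"
    and M N \<nu> \<xi> \<theta>\<^sub>f \<tau>\<^sub>s \<tau> G \<eta> \<sigma> :: real
  assumes "generates dom_A A T"
    and "M \<ge> 1" and "\<nu> > 0" and "\<forall>t\<ge>0. norm (T t) \<le> M * exp (\<nu> * t)"
    and "compact_operator F"
    and "generates dom_A (\<lambda>x. A x + B (F x)) T\<^sub>B\<^sub>F"
    and "N \<ge> 1" and "\<xi> > 0" and "\<forall>t\<ge>0. norm (T\<^sub>B\<^sub>F t) \<le> N * exp (- \<xi> * t)"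
    and "\<exists>L. L-lipschitz_on UNIV (\<lambda>x. f (F x))"
    and "\<theta>\<^sub>f > 0" and "\<forall>x. norm (f (F x) - F x) \<le> \<theta>\<^sub>f * norm x"
    and "\<theta>\<^sub>f * (M * N * norm B) < \<xi>"
    and "\<tau>\<^sub>s > 0" and "\<forall>\<tau>'. 0 < \<tau>' \<and> \<tau>' < \<tau>\<^sub>s \<longrightarrow> power_stable (sampled_data_map T B f F \<tau>')"
    and "0 < \<tau>" and "\<tau> < \<tau>\<^sub>s"
    and "G \<ge> 1" and "\<eta> > 0"
    and "\<forall>x0 x. sampled_data_solution T B f F \<tau> x0 x \<longrightarrow>
           (\<forall>t\<ge>0. norm (x t) \<le> G * exp (- \<eta> * t) * norm x0)"
    and "coercive_ISS_Lyapunov T B f F V \<psi>1 \<psi>2 \<alpha> \<gamma>"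
    and "0 < \<sigma>" and "\<sigma> < 1"
    and "class_KL \<kappa>" and "comparison_property \<kappa> \<alpha> \<sigma>"
    and "\<exists>\<mu> \<omega>. class_KL \<mu> \<and> class_L \<omega> \<and>
           (\<forall>K\<ge>1. \<forall>m\<ge>0. \<forall>n. (\<forall>j\<in>{1..K}. n j \<ge> 0) \<longrightarrow>
              iterate_R (rho \<psi>1 \<psi>2 \<kappa> G \<eta> \<tau>) K m n \<le> \<mu> (\<omega> (real K) * m) (Max (n ` {1..K})))"
  shows "UGAS (event_triggered_solution T B f F V \<alpha> \<gamma> \<sigma> \<tau>)"
proof -
  have T: "exp_bounded_semigroup T M \<nu>"
    using assms(1-4) by unfold_locales (auto simp: generates_def)
  note f = \<open>\<exists>L. L-lipschitz_on UNIV (\<lambda>x. f (F x))\<close>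
    and V = \<open>coercive_ISS_Lyapunov T B f F V \<psi>1 \<psi>2 \<alpha> \<gamma>\<close>
    and \<kappa> = \<open>class_KL \<kappa>\<close> \<open>comparison_property \<kappa> \<alpha> \<sigma>\<close>
  have G: "0 < G"
    using \<open>G \<ge> 1\<close> by simp
  from assms(26) obtain \<mu> \<omega> where \<mu>: "class_KL \<mu>" and \<omega>: "class_L \<omega>"
    and iterates: "\<forall>K\<ge>1. \<forall>m\<ge>0. \<forall>n. (\<forall>j\<in>{1..K}. n j \<ge> 0) \<longrightarrow>
      iterate_R (rho \<psi>1 \<psi>2 \<kappa> G \<eta> \<tau>) K m n \<le> \<mu> (\<omega> (real K) * m) (Max (n ` {1..K}))"
    by (elim exE conjE)
  show ?thesis
    unfolding UGAS_def
  proof (rule exI, intro conjI allI impI)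
    show "class_KL (\<lambda>r t. G * exp (- \<eta> * t) * r +
        G * (\<mu> (\<omega> (sqrt (max 0 (t - \<tau>))) * r) 0 +
          \<mu> (\<omega> 0 * r) (max 0 (sqrt (max 0 (t - \<tau>)) - \<tau>))))"
      by (rule class_KL_event_bound[OF \<mu> \<omega> G \<open>\<eta> > 0\<close>])
    show "\<exists>x. event_triggered_solution T B f F V \<alpha> \<gamma> \<sigma> \<tau> x0 x" for x0
      by (rule exp_bounded_semigroup.ex_event_triggered_solution[OF T V f \<open>0 < \<tau>\<close>])
    show "norm (x t) \<le> G * exp (- \<eta> * t) * norm x0 +
        G * (\<mu> (\<omega> (sqrt (max 0 (t - \<tau>))) * norm x0) 0 +
          \<mu> (\<omega> 0 * norm x0) (max 0 (sqrt (max 0 (t - \<tau>)) - \<tau>)))"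
      if "event_triggered_solution T B f F V \<alpha> \<gamma> \<sigma> \<tau> x0 x" "0 \<le> t" for x0 x t
      by (rule exp_bounded_semigroup.norm_event_triggered_solution_le[OF T V f \<kappa> \<open>\<sigma> < 1\<close>
            \<open>0 < \<tau>\<close> \<open>G \<ge> 1\<close> \<open>\<eta> > 0\<close> assms(20) \<mu> \<omega> _ that]) (use iterates in simp)
  qed
qed

end
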